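(* We have $\|R(is,A)\|=O(|s|^{1/2})$ as $|s|\to\infty$, $s\in\mathbb{R}$; that is, there are constants $C,s_0>0$ such that $\|R(is,A)\|\le C|s|^{1/2}$ for all $s\in\mathbb{R}$ with $|s|\ge s_0$.
   Context: All function spaces are complex. Let $X=H^1(-1,0)\times L^2(-1,0)\times L^2(0,1)$ and $Y=H^2(-1,0)\times H^1(-1,0)\times H^2(0,1)$, both with their natural Hilbert space norms. Let $A$ be the closed, densely defined operator on $X$ given by $Ax=(v,u'',w'')$ for $x=(u,v,w)$ in the domain $$D(A)=\{(u,v,w)\in Y: u'(-1)=w(1)=0,\ v(0)=w(0),\ u'(0)=w'(0)\}.$$ The spectrum satisfies $\sigma(A)\cap i\mathbb{R}=\{0\}$, so the resolvent operator $R(is,A)=(is-A)^{-1}$ exists for all $s\in\mathbb{R}\setminus\{0\}$. The norm $\|R(is,A)\|$ is the operator norm on $X$. *)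

theory Defs
  imports "HOL-Analysis.Analysis" "HOL-Real_Asymp.Real_Asymp"
begin

section \<open>Complex normed spaces, unbounded operators, resolvents\<close>

class complex_normed_space = real_normed_vector +
  fixes scaleC :: "complex \<Rightarrow> 'a \<Rightarrow> 'a"  (infixr "*\<^sub>C" 75)
  assumes scaleC_add_right: "c *\<^sub>C (x + y) = c *\<^sub>C x + c *\<^sub>C y"
    and scaleC_add_left: "(b + c) *\<^sub>C x = b *\<^sub>C x + c *\<^sub>C x"
    and scaleC_scaleC: "b *\<^sub>C (c *\<^sub>C x) = (b * c) *\<^sub>C x"
    and scaleC_of_real: "complex_of_real r *\<^sub>C x = r *\<^sub>R x"
    and norm_scaleC: "norm (c *\<^sub>C x) = cmod c * norm x"

instantiation prod :: (complex_normed_space, complex_normed_space) complex_normed_space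
begin

definition scaleC_prod_def: "c *\<^sub>C p = (c *\<^sub>C fst p, c *\<^sub>C snd p)"

instance
proof
  fix c :: complex and x :: "'a \<times> 'b"
  have "(norm (c *\<^sub>C x))\<^sup>2 = (cmod c * norm x)\<^sup>2"
    by (simp add: scaleC_prod_def norm_prod_def norm_scaleC power_mult_distrib distrib_left)
  then show "norm (c *\<^sub>C x) = cmod c * norm x"
    by (simp add: power2_eq_iff_nonneg)
qed (simp_all add: scaleC_prod_def scaleC_add_right scaleC_add_left scaleC_scaleC scaleC_of_real
      scaleR_prod_def)

end

text \<open>An unbounded operator is given by its domain \<open>D\<close> and a function \<open>A\<close>, of which only the
  values on \<open>D\<close> matter.\<close>

definition resolvent :: "'a set \<Rightarrow> ('a \<Rightarrow> 'a) \<Rightarrow> complex \<Rightarrow> 'a \<Rightarrow> 'a::complex_normed_space" where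
  "resolvent D A l = inv_into D (\<lambda>x. l *\<^sub>C x - A x)"

definition resolvent_set :: "'a::complex_normed_space set \<Rightarrow> ('a \<Rightarrow> 'a) \<Rightarrow> complex set" where
  "resolvent_set D A =
    {l. bij_betw (\<lambda>x. l *\<^sub>C x - A x) D UNIV \<and> bounded_linear (resolvent D A l)}"


section \<open>Lebesgue spaces on bounded intervals\<close>

text \<open>Since Isabelle types cannot depend on real numbers, an open bounded interval is named by an
  index type, which makes \<open>L\<^sup>2\<close> and \<open>H\<^sup>1\<close> of that interval honest types.\<close>

class bounded_interval =
  fixes left_end :: "'a itself \<Rightarrow> real" and right_end :: "'a itself \<Rightarrow> real"
  assumes left_less_right: "left_end TYPE('a) < right_end TYPE('a)"

text \<open>Borel measurable representatives suffice: every Lebesgue measurable function is almost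
  everywhere equal to one.\<close>

definition leb :: "'i::bounded_interval itself \<Rightarrow> real measure" where
  "leb i = restrict_space lborel {left_end i<..<right_end i}"

definition square_integrable :: "'i::bounded_interval itself \<Rightarrow> (real \<Rightarrow> complex) \<Rightarrow> bool" where
  "square_integrable i f \<longleftrightarrow>
    f \<in> borel_measurable (leb i) \<and> integrable (leb i) (\<lambda>x. (cmod (f x))\<^sup>2)"

definition l2_rel :: "'i::bounded_interval itself \<Rightarrow> (real \<Rightarrow> complex) \<Rightarrow> (real \<Rightarrow> complex) \<Rightarrow> bool"
  where "l2_rel i f g \<longleftrightarrow>
    square_integrable i f \<and> square_integrable i g \<and> (AE x in leb i. f x = g x)"

lemma finite_measure_leb: "finite_measure (leb i)"
proof (rule finite_measureI)
  have "emeasure lborel {left_end i<..<right_end i} < \<infinity>"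
    by (intro emeasure_bounded_finite) simp
  then show "emeasure (leb i) (space (leb i)) \<noteq> \<infinity>"
    by (simp add: leb_def space_restrict_space emeasure_restrict_space)
qed

lemma square_integrable_zero: "square_integrable i (\<lambda>_. 0)"
  by (simp add: square_integrable_def)

lemma square_integrable_add:
  assumes "square_integrable i f" "square_integrable i g"
  shows "square_integrable i (\<lambda>x. f x + g x)"
proof -
  note [measurable] = assms[unfolded square_integrable_def, THEN conjunct1]
  have "integrable (leb i) (\<lambda>x. 2 * (cmod (f x))\<^sup>2 + 2 * (cmod (g x))\<^sup>2)"
    using assms by (auto simp: square_integrable_def)
  moreover have "(cmod (f x + g x))\<^sup>2 \<le> 2 * (cmod (f x))\<^sup>2 + 2 * (cmod (g x))\<^sup>2" for x
  proof -
    have "(cmod (f x + g x))\<^sup>2 \<le> (cmod (f x) + cmod (g x))\<^sup>2"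
      by (intro power_mono norm_triangle_ineq norm_ge_zero)
    also have "\<dots> \<le> 2 * (cmod (f x))\<^sup>2 + 2 * (cmod (g x))\<^sup>2"
      using sum_squares_bound[of "cmod (f x)" "cmod (g x)"] by (simp add: power2_sum)
    finally show ?thesis .
  qed
  ultimately have "integrable (leb i) (\<lambda>x. (cmod (f x + g x))\<^sup>2)"
    by (elim Bochner_Integration.integrable_bound) auto
  then show ?thesis by (simp add: square_integrable_def)
qed

lemma square_integrable_scale:
  assumes "square_integrable i f"
  shows "square_integrable i (\<lambda>x. c * f x)"
  using assms by (auto simp: square_integrable_def norm_mult power_mult_distrib)

lemma square_integrable_diff:
  assumes "square_integrable i f" "square_integrable i g"
  shows "square_integrable i (\<lambda>x. f x - g x)"
  using square_integrable_add[OF assms(1) square_integrable_scale[OF assms(2), of "-1"]] by simp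

lemma square_integrable_uminus:
  assumes "square_integrable i f"
  shows "square_integrable i (\<lambda>x. - f x)"
  using square_integrable_scale[OF assms, of "-1"] by simp

lemma square_integrable_inner:
  assumes "square_integrable i f" "square_integrable i g"
  shows "integrable (leb i) (\<lambda>x. f x \<bullet> g x)"
proof -
  note [measurable] = assms[unfolded square_integrable_def, THEN conjunct1]
  have "integrable (leb i) (\<lambda>x. (cmod (f x))\<^sup>2 + (cmod (g x))\<^sup>2)"
    using assms by (auto simp: square_integrable_def)
  moreover have "\<bar>f x \<bullet> g x\<bar> \<le> (cmod (f x))\<^sup>2 + (cmod (g x))\<^sup>2" for x
    using Cauchy_Schwarz_ineq2[of "f x" "g x"] sum_squares_bound[of "cmod (f x)" "cmod (g x)"]
      mult_nonneg_nonneg[OF norm_ge_zero norm_ge_zero, of "f x" "g x"] by linarith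
  ultimately show ?thesis
    by (elim Bochner_Integration.integrable_bound) auto
qed

lemma square_integrable_mult_bounded:
  assumes f: "square_integrable i f" and [measurable]: "p \<in> borel_measurable borel"
    and p: "\<And>x. \<bar>p x\<bar> \<le> B"
  shows "integrable (leb i) (\<lambda>x. f x * complex_of_real (p x))"
proof -
  interpret finite_measure "leb i" by (rule finite_measure_leb)
  note [measurable] = f[unfolded square_integrable_def, THEN conjunct1]
  have [measurable]: "p \<in> borel_measurable (leb i)"
    by (simp add: leb_def measurable_restrict_space1)
  have int: "integrable (leb i) (\<lambda>x. B * (1 + (cmod (f x))\<^sup>2))"
    using f unfolding square_integrable_def
    by (intro integrable_mult_right Bochner_Integration.integrable_add integrable_const) blast
  have bound: "cmod (f x * complex_of_real (p x)) \<le> norm (B * (1 + (cmod (f x))\<^sup>2))" for x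
  proof -
    define n where "n = cmod (f x)"
    have "0 \<le> n" "2 * n \<le> 1 + n\<^sup>2"
      using sum_squares_bound[of 1 n] by (simp_all add: n_def)
    then have "n \<le> 1 + n\<^sup>2" by linarith
    moreover have "0 \<le> B" using p[of 0] by linarith
    ultimately have "n * \<bar>p x\<bar> \<le> (1 + n\<^sup>2) * B"
      by (intro mult_mono p abs_ge_zero add_nonneg_nonneg zero_le_one zero_le_power2)
    moreover have "norm (B * (1 + n\<^sup>2)) = (1 + n\<^sup>2) * B"
      using \<open>0 \<le> B\<close> by (simp add: abs_mult mult.commute)
    ultimately show ?thesis by (simp add: n_def norm_mult)
  qed
  show ?thesis
    by (rule Bochner_Integration.integrable_bound[OF int _ AE_I2[OF bound]]) measurable
qed

lemma part_equivp_l2_rel: "part_equivp (l2_rel i)"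
proof (rule part_equivpI)
  show "\<exists>f. l2_rel i f f"
    using square_integrable_zero by (auto simp: l2_rel_def)
  show "symp (l2_rel i)"
    by (auto simp: symp_def l2_rel_def)
  show "transp (l2_rel i)"
    unfolding transp_def l2_rel_def by (auto elim!: AE_mp)
qed

lemma l2_rel_iff:
  "l2_rel i f g \<longleftrightarrow> l2_rel i f f \<and> l2_rel i g g \<and> Collect (l2_rel i f) = Collect (l2_rel i g)"
  using part_equivp_l2_rel[of i] unfolding part_equivp_def by (metis Collect_inj)

lemma l2_rel_refl_iff: "l2_rel i f f \<longleftrightarrow> square_integrable i f"
  by (simp add: l2_rel_def)

typedef (overloaded) 'i L2 =
  "{Collect (l2_rel TYPE('i::bounded_interval) f) | f. square_integrable TYPE('i) f}"
  using square_integrable_zero by blast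

definition abs_L2 :: "(real \<Rightarrow> complex) \<Rightarrow> 'i::bounded_interval L2" where
  "abs_L2 f = Abs_L2 (Collect (l2_rel TYPE('i) f))"

definition rep_L2 :: "'i::bounded_interval L2 \<Rightarrow> real \<Rightarrow> complex" where
  "rep_L2 u = (SOME f. f \<in> Rep_L2 u)"

definition represents_L2 :: "(real \<Rightarrow> complex) \<Rightarrow> 'i::bounded_interval L2 \<Rightarrow> bool" where
  "represents_L2 f u \<longleftrightarrow> square_integrable TYPE('i) f \<and> abs_L2 f = u"

lemma rep_L2:
  fixes u :: "'i::bounded_interval L2"
  shows "square_integrable TYPE('i) (rep_L2 u)" and "abs_L2 (rep_L2 u) = u"
proof -
  obtain f where f: "square_integrable TYPE('i) f" "Rep_L2 u = Collect (l2_rel TYPE('i) f)"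
    using Rep_L2[of u] by blast
  then have "f \<in> Rep_L2 u" by (simp add: l2_rel_refl_iff)
  then have "rep_L2 u \<in> Rep_L2 u"
    unfolding rep_L2_def by (rule someI[of "\<lambda>f. f \<in> Rep_L2 u"])
  then have *: "l2_rel TYPE('i) f (rep_L2 u)" using f by simp
  then show "square_integrable TYPE('i) (rep_L2 u)" by (simp add: l2_rel_def)
  have "Collect (l2_rel TYPE('i) (rep_L2 u)) = Rep_L2 u"
    using * l2_rel_iff[of "TYPE('i)" f "rep_L2 u"] f(2) by simp
  then show "abs_L2 (rep_L2 u) = u"
    by (simp add: abs_L2_def Rep_L2_inverse)
qed

lemma Quotient_L2:
  "Quotient (l2_rel TYPE('i)) abs_L2 rep_L2 (represents_L2 :: _ \<Rightarrow> 'i::bounded_interval L2 \<Rightarrow> bool)"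
proof (rule QuotientI)
  show "abs_L2 (rep_L2 u) = u" "l2_rel TYPE('i) (rep_L2 u) (rep_L2 u)" for u :: "'i L2"
    by (simp_all add: l2_rel_refl_iff rep_L2)
  show "l2_rel TYPE('i) f g \<longleftrightarrow>
      l2_rel TYPE('i) f f \<and> l2_rel TYPE('i) g g \<and> (abs_L2 f :: 'i L2) = abs_L2 g" for f g
  proof -
    have "(abs_L2 f :: 'i L2) = abs_L2 g \<longleftrightarrow>
        Collect (l2_rel TYPE('i) f) = Collect (l2_rel TYPE('i) g)"
      if "square_integrable TYPE('i) f" "square_integrable TYPE('i) g"
      unfolding abs_L2_def by (rule Abs_L2_inject) (use that in blast)+
    then show ?thesis
      using l2_rel_iff[of "TYPE('i)" f g] unfolding l2_rel_refl_iff by argo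
  qed
  show "(represents_L2 :: _ \<Rightarrow> 'i L2 \<Rightarrow> bool) = (\<lambda>f u. l2_rel TYPE('i) f f \<and> abs_L2 f = u)"
    unfolding represents_L2_def l2_rel_refl_iff by (rule refl)
qed

setup_lifting Quotient_L2

text \<open>The real inner product \<open>inner\<close> on \<open>L\<^sup>2\<close> is the real part of the usual complex one;
  both induce the norm \<open>(\<integral>|f|\<^sup>2)\<^bsup>1/2\<^esup>\<close>.\<close>

instantiation L2 :: (bounded_interval) real_inner
begin

lift_definition zero_L2 :: "'a L2" is "\<lambda>_. 0"
  by (simp add: l2_rel_def square_integrable_zero)

lift_definition plus_L2 :: "'a L2 \<Rightarrow> 'a L2 \<Rightarrow> 'a L2" is "\<lambda>f g x. f x + g x"
  by (auto simp: l2_rel_def square_integrable_add elim!: AE_mp)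

lift_definition uminus_L2 :: "'a L2 \<Rightarrow> 'a L2" is "\<lambda>f x. - f x"
  by (auto simp: l2_rel_def square_integrable_uminus elim!: AE_mp)

lift_definition minus_L2 :: "'a L2 \<Rightarrow> 'a L2 \<Rightarrow> 'a L2" is "\<lambda>f g x. f x - g x"
  by (auto simp: l2_rel_def square_integrable_diff elim!: AE_mp)

lift_definition scaleR_L2 :: "real \<Rightarrow> 'a L2 \<Rightarrow> 'a L2" is "\<lambda>r f x. complex_of_real r * f x"
  by (auto simp: l2_rel_def square_integrable_scale elim!: AE_mp)

lift_definition inner_L2 :: "'a L2 \<Rightarrow> 'a L2 \<Rightarrow> real" is
  "\<lambda>f g. LINT x|leb TYPE('a). f x \<bullet> g x"
  unfolding l2_rel_def square_integrable_def
  by (rule integral_cong_AE) (auto elim!: AE_mp)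

definition norm_L2 :: "'a L2 \<Rightarrow> real" where "norm_L2 u = sqrt (u \<bullet> u)"

definition sgn_L2 :: "'a L2 \<Rightarrow> 'a L2" where "sgn_L2 u = inverse (norm u) *\<^sub>R u"

definition dist_L2 :: "'a L2 \<Rightarrow> 'a L2 \<Rightarrow> real" where "dist_L2 u v = norm (u - v)"

definition uniformity_L2 :: "('a L2 \<times> 'a L2) filter" where
  "uniformity_L2 = (INF e\<in>{0 <..}. principal {(x, y). dist x y < e})"

definition open_L2 :: "'a L2 set \<Rightarrow> bool" where
  "open_L2 U \<longleftrightarrow> (\<forall>x\<in>U. eventually (\<lambda>(x', y). x' = x \<longrightarrow> y \<in> U) uniformity)"

instance
proof
  fix u v w :: "'a L2" and r s :: real
  show "u + v + w = u + (v + w)"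
    by transfer (auto simp: l2_rel_def square_integrable_add add.assoc)
  show "u + v = v + u"
    by transfer (auto simp: l2_rel_def square_integrable_add add.commute)
  show "0 + u = u"
    by transfer (auto simp: l2_rel_def)
  show "- u + u = 0"
    by transfer (auto simp: l2_rel_def square_integrable_zero)
  show "u - v = u + - v"
    by transfer (auto simp: l2_rel_def square_integrable_diff)
  show "r *\<^sub>R (u + v) = r *\<^sub>R u + r *\<^sub>R v"
    by transfer (auto simp: l2_rel_def distrib_left distrib_right
        intro: square_integrable_add square_integrable_scale)
  show "(r + s) *\<^sub>R u = r *\<^sub>R u + s *\<^sub>R u"
    by transfer (auto simp: l2_rel_def distrib_left distrib_right
        intro: square_integrable_add square_integrable_scale)
  show "r *\<^sub>R s *\<^sub>R u = (r * s) *\<^sub>R u"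
    by transfer (auto simp: l2_rel_def square_integrable_scale mult.assoc
      simp flip: mult.assoc intro!: square_integrable_scale)
  show "1 *\<^sub>R u = u"
    by transfer (auto simp: l2_rel_def)
  show "u \<bullet> v = v \<bullet> u"
    by transfer (simp add: inner_commute)
  show "(u + v) \<bullet> w = u \<bullet> w + v \<bullet> w"
    by transfer (simp add: l2_rel_def inner_add_left Bochner_Integration.integral_add
        square_integrable_inner)
  show "(r *\<^sub>R u) \<bullet> v = r * (u \<bullet> v)"
    by transfer (simp flip: scaleR_conv_of_real)
  show "0 \<le> u \<bullet> u"
    by transfer (simp add: integral_nonneg_AE)
  show "u \<bullet> u = 0 \<longleftrightarrow> u = 0"
    by transfer (auto simp: l2_rel_def square_integrable_zero integral_nonneg_eq_0_iff_AE
        square_integrable_inner)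
qed (rule norm_L2_def sgn_L2_def dist_L2_def uniformity_L2_def open_L2_def)+

end

instantiation L2 :: (bounded_interval) complex_normed_space
begin

lift_definition scaleC_L2 :: "complex \<Rightarrow> 'a L2 \<Rightarrow> 'a L2" is "\<lambda>c f x. c * f x"
  by (auto simp: l2_rel_def square_integrable_scale elim!: AE_mp)

instance
proof
  fix u v :: "'a L2" and b c :: complex and r :: real
  show "c *\<^sub>C (u + v) = c *\<^sub>C u + c *\<^sub>C v"
    by transfer (auto simp: l2_rel_def distrib_left distrib_right
        intro: square_integrable_add square_integrable_scale)
  show "(b + c) *\<^sub>C u = b *\<^sub>C u + c *\<^sub>C u"
    by transfer (auto simp: l2_rel_def distrib_left distrib_right
        intro: square_integrable_add square_integrable_scale)
  show "b *\<^sub>C (c *\<^sub>C u) = (b * c) *\<^sub>C u"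
    by transfer (auto simp: l2_rel_def simp flip: mult.assoc intro!: square_integrable_scale)
  show "complex_of_real r *\<^sub>C u = r *\<^sub>R u"
    by transfer (auto simp: l2_rel_def square_integrable_scale)
  have "(c *\<^sub>C u) \<bullet> (c *\<^sub>C u) = (cmod c)\<^sup>2 * (u \<bullet> u)"
    by transfer (simp add: dot_square_norm norm_mult power_mult_distrib)
  then show "norm (c *\<^sub>C u) = cmod c * norm u"
    by (simp add: norm_eq_sqrt_inner real_sqrt_mult)
qed

end


section \<open>Weak derivatives\<close>

definition smooth :: "(real \<Rightarrow> real) \<Rightarrow> bool" where
  "smooth p \<longleftrightarrow> (\<forall>k x. (deriv ^^ k) p differentiable (at x))"

text \<open>Test functions are elements of \<open>C\<^sub>c\<^sup>\<infinity>\<close> of the open interval; real-valued ones suffice,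
  as the defining identity of the weak derivative is complex linear in the test function.\<close>

definition test_function :: "'i::bounded_interval itself \<Rightarrow> (real \<Rightarrow> real) \<Rightarrow> bool" where
  "test_function i p \<longleftrightarrow> smooth p \<and>
    (\<exists>c d. left_end i < c \<and> d < right_end i \<and> (\<forall>x. x \<notin> {c..d} \<longrightarrow> p x = 0))"

text \<open>Test functions are supplied by products of \<open>exp (- 1 / x)\<close> cut off at \<open>0\<close>; they are
  needed to show that weak derivatives are unique.\<close>

definition flat :: "nat \<Rightarrow> real \<Rightarrow> real" where
  "flat k x = (if x > 0 then exp (- 1 / x) / x ^ k else 0)"

inductive bump :: "(real \<Rightarrow> real) \<Rightarrow> bool" where
  bump_const: "bump (\<lambda>_. c)"
| bump_flat: "bump (\<lambda>x. flat k (a * x + b))"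
| bump_add: "bump p \<Longrightarrow> bump q \<Longrightarrow> bump (\<lambda>x. p x + q x)"
| bump_mult: "bump p \<Longrightarrow> bump q \<Longrightarrow> bump (\<lambda>x. p x * q x)"

lemma flat_div_tendsto_0: "((\<lambda>h. flat k h / h) \<longlongrightarrow> 0) (at 0)"
proof -
  have *: "((\<lambda>h::real. inverse h ^ Suc k / exp (inverse h)) \<longlongrightarrow> 0) (at_right 0)"
    by (rule filterlim_compose[OF tendsto_power_div_exp_0 filterlim_inverse_at_top_right])
  have "((\<lambda>h. flat k h / h) \<longlongrightarrow> 0) (at_right 0)"
    by (rule Lim_transform_eventually[OF *])
      (auto simp: flat_def exp_minus divide_simps eventually_at_filter)
  moreover have "((\<lambda>h. flat k h / h) \<longlongrightarrow> 0) (at_left 0)"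
    by (rule Lim_transform_eventually[OF tendsto_const]) (auto simp: flat_def eventually_at_filter)
  ultimately show ?thesis
    by (simp add: filterlim_split_at)
qed

lemma DERIV_flat: "(flat k has_real_derivative flat (k + 2) x - real k * flat (k + 1) x) (at x)"
proof -
  consider "x > 0" | "x < 0" | "x = 0" by linarith
  then show ?thesis
  proof cases
    case 1
    have "((\<lambda>x. exp (- 1 / x) / x ^ k) has_real_derivative
        (exp (- 1 / x) * (1 / x\<^sup>2) * x ^ k - exp (- 1 / x) * (real k * x ^ (k - 1))) / (x ^ k * x ^ k))
        (at x)"
      using 1 by (auto intro!: derivative_eq_intros simp: power2_eq_square)
    moreover have "real k * x ^ (k - 1) = real k * (x ^ k / x)"
      using 1 by (cases k) auto
    moreover have "(exp (- 1 / x) * (1 / x\<^sup>2) * x ^ k - exp (- 1 / x) * (real k * (x ^ k / x))) /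
        (x ^ k * x ^ k) = flat (k + 2) x - real k * flat (k + 1) x"
      using 1 by (simp add: flat_def field_simps power2_eq_square)
    ultimately have "((\<lambda>x. exp (- 1 / x) / x ^ k) has_real_derivative
        flat (k + 2) x - real k * flat (k + 1) x) (at x)"
      by simp
    then show ?thesis
      by (rule has_field_derivative_transform_within_open[where S = "{0<..}"])
        (use 1 in \<open>auto simp: flat_def\<close>)
  next
    case 2
    have "((\<lambda>_. 0) has_real_derivative flat (k + 2) x - real k * flat (k + 1) x) (at x)"
      using 2 by (simp add: flat_def)
    then show ?thesis
      by (rule has_field_derivative_transform_within_open[where S = "{..<0}"])
        (use 2 in \<open>auto simp: flat_def\<close>)
  next
    case 3
    then show ?thesis
      using flat_div_tendsto_0[of k] by (simp add: has_field_derivative_iff flat_def[of _ 0])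
  qed
qed

lemma bump_has_derivative: "bump p \<Longrightarrow> \<exists>p'. bump p' \<and> (\<forall>x. (p has_real_derivative p' x) (at x))"
proof (induction rule: bump.induct)
  case (bump_const c)
  show ?case by (intro exI[of _ "\<lambda>_. 0"] conjI bump.bump_const) auto
next
  case (bump_flat k a b)
  let ?p' = "\<lambda>x. a * (flat (k + 2) (a * x + b) + (- real k) * flat (k + 1) (a * x + b))"
  have "bump ?p'"
    by (rule bump.bump_mult[OF bump.bump_const bump.bump_add[OF bump.bump_flat
            bump.bump_mult[OF bump.bump_const bump.bump_flat]]])
  moreover have "((\<lambda>x. flat k (a * x + b)) has_real_derivative ?p' x) (at x)" for x
    by (rule DERIV_cong[OF DERIV_chain2[OF DERIV_flat]]) (auto intro!: derivative_eq_intros)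
  ultimately show ?case by blast
next
  case (bump_add p q)
  then obtain p' q' where "bump p'" "bump q'" "\<And>x. (p has_real_derivative p' x) (at x)"
    "\<And>x. (q has_real_derivative q' x) (at x)" by blast
  then show ?case
    by (intro exI[of _ "\<lambda>x. p' x + q' x"] conjI allI DERIV_add bump.bump_add)
next
  case (bump_mult p q)
  then obtain p' q' where "bump p'" "bump q'" "\<And>x. (p has_real_derivative p' x) (at x)"
    "\<And>x. (q has_real_derivative q' x) (at x)" by blast
  with bump_mult show ?case
    by (intro exI[of _ "\<lambda>x. p' x * q x + q' x * p x"] conjI allI DERIV_mult bump.bump_add
        bump.bump_mult)
qed

lemma bump_deriv: "bump p \<Longrightarrow> bump (deriv p)"
proof -
  assume "bump p"
  then obtain p' where "bump p'" and "\<And>x. (p has_real_derivative p' x) (at x)"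
    using bump_has_derivative by blast
  moreover from this have "deriv p = p'" by (simp add: fun_eq_iff DERIV_imp_deriv)
  ultimately show ?thesis by simp
qed

lemma bump_smooth:
  assumes "bump p" shows "smooth p"
proof -
  have "bump ((deriv ^^ k) p)" for k
    by (induction k) (auto intro: bump_deriv assms)
  then show ?thesis
    unfolding smooth_def real_differentiable_def using bump_has_derivative by blast
qed

lemma smooth_deriv: "smooth p \<Longrightarrow> smooth (deriv p)"
  unfolding smooth_def by (metis comp_apply funpow_Suc_right)

lemma test_function_deriv: "test_function i p \<Longrightarrow> test_function i (deriv p)"
proof -
  assume p: "test_function i p"
  then obtain c d where cd: "left_end i < c" "d < right_end i" "\<And>x. x \<notin> {c..d} \<Longrightarrow> p x = 0"
    unfolding test_function_def by blast
  have "deriv p x = 0" if "x \<notin> {c..d}" for x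
  proof (rule DERIV_imp_deriv, rule has_field_derivative_transform_within_open)
    show "((\<lambda>_. 0) has_real_derivative 0) (at x)" by simp
    show "open (- {c..d})" by (simp add: open_Compl)
  qed (use that cd(3) in auto)
  with p cd show ?thesis
    unfolding test_function_def by (blast intro: smooth_deriv)
qed

lemma test_function_continuous:
  assumes "test_function i p" shows "continuous_on S p"
proof -
  have "(deriv ^^ 0) p differentiable (at x)" for x
    using assms unfolding test_function_def smooth_def by blast
  then show ?thesis
    by (simp add: continuous_at_imp_continuous_on differentiable_imp_continuous_within)
qed

lemma test_function_measurable: "test_function i p \<Longrightarrow> p \<in> borel_measurable borel"
  by (intro borel_measurable_continuous_onI test_function_continuous)

lemma test_function_bounded:
  assumes "test_function i p" obtains B where "\<And>x. \<bar>p x\<bar> \<le> B"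
proof -
  obtain c d where cd: "\<And>x. x \<notin> {c..d} \<Longrightarrow> p x = 0"
    using assms unfolding test_function_def by blast
  have "bounded (p ` {c..d})"
    by (intro compact_imp_bounded compact_continuous_image test_function_continuous[OF assms]) simp
  then obtain B where B: "B > 0" "\<And>x. x \<in> {c..d} \<Longrightarrow> \<bar>p x\<bar> \<le> B"
    unfolding bounded_pos by auto
  have "\<bar>p x\<bar> \<le> B" for x
    using B cd[of x] by (cases "x \<in> {c..d}") auto
  then show thesis by (rule that)
qed

lemma integrable_mult_test:
  assumes "square_integrable i f" "test_function i p"
  shows "integrable (leb i) (\<lambda>x. f x * complex_of_real (p x))"
  by (rule test_function_bounded[OF assms(2)])
    (rule square_integrable_mult_bounded[OF assms(1) test_function_measurable[OF assms(2)]])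

lemma integral_test_cong:
  assumes "l2_rel i f g" "test_function i p"
  shows "(LINT x|leb i. f x * complex_of_real (p x)) = (LINT x|leb i. g x * complex_of_real (p x))"
proof (rule integral_cong_AE)
  show "(\<lambda>x. f x * complex_of_real (p x)) \<in> borel_measurable (leb i)"
    "(\<lambda>x. g x * complex_of_real (p x)) \<in> borel_measurable (leb i)"
    using assms by (auto simp: l2_rel_def intro!: borel_measurable_integrable integrable_mult_test)
  show "AE x in leb i. f x * complex_of_real (p x) = g x * complex_of_real (p x)"
    using assms by (auto simp: l2_rel_def elim: eventually_mono)
qed

lemma square_integrable_integrable:
  assumes "square_integrable i f" shows "integrable (leb i) f"
  using square_integrable_mult_bounded[OF assms, of "\<lambda>_. 1" 1] by simp

lemma AE_zero_if_orthogonal: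
  fixes i :: "'i::bounded_interval itself"
  assumes f: "square_integrable i f"
    and orth: "\<And>p. test_function i p \<Longrightarrow> (LINT x|leb i. f x * complex_of_real (p x)) = 0"
  shows "AE x in leb i. f x = 0"
proof -
  let ?I = "{left_end i<..<right_end i}"
  define F where "F = (\<lambda>x. indicator ?I x *\<^sub>R f x)"
  have F: "integrable lborel F"
    using square_integrable_integrable[OF f] unfolding leb_def F_def
    by (subst (asm) integrable_restrict_space) auto
  have F_orth: "(LINT x|lborel. F x * complex_of_real (p x)) = 0" if "test_function i p" for p
    using orth[OF that] unfolding leb_def F_def
    by (subst (asm) integral_restrict_space) auto
  have ivl: "(LINT x:{c<..<d}|lborel. F x) = 0" if cd: "left_end i \<le> c" "d \<le> right_end i" for c d
  proof -
    define p where "p = (\<lambda>(n::nat) x. flat 0 (real (Suc n) * x + (- real (Suc n) * c - 1)) *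
        flat 0 (- real (Suc n) * x + (real (Suc n) * d - 1)))"
    have p_nonzero: "c + 1 / real (Suc n) < x \<and> x < d - 1 / real (Suc n)" if "p n x \<noteq> 0" for n x
      using that by (auto simp: p_def flat_def field_simps split: if_splits)
    have p: "test_function i (p n)" for n
      unfolding test_function_def
    proof (intro conjI exI allI impI)
      show "smooth (p n)"
        unfolding p_def by (intro bump_smooth bump.intros)
      show "left_end i < c + 1 / real (Suc n)" "d - 1 / real (Suc n) < right_end i"
        using cd zero_less_divide_1_iff[of "real (Suc n)"] by linarith+
    qed (use p_nonzero[of n] in force)
    have p_bound: "\<bar>p n x\<bar> \<le> 1" for n x
      unfolding p_def by (auto simp: flat_def abs_mult intro!: mult_le_one)
    have p_lim: "(\<lambda>n. p n x) \<longlonglongrightarrow> indicator {c<..<d} x" for x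
    proof (cases "x \<in> {c<..<d}")
      case True
      have lim: "(\<lambda>n. flat 0 (real (Suc n) * y - 1)) \<longlonglongrightarrow> 1" if "y > 0" for y
      proof -
        have top: "filterlim (\<lambda>n. real (Suc n) * y - 1) at_top sequentially"
          using that by real_asymp
        have "((\<lambda>t::real. exp (- 1 / t)) \<longlongrightarrow> 1) at_top" by real_asymp
        moreover have "eventually (\<lambda>t. exp (- 1 / t) = flat 0 t) at_top"
          using eventually_gt_at_top[of 0] by eventually_elim (simp add: flat_def)
        ultimately have "(flat 0 \<longlongrightarrow> 1) at_top" by (rule Lim_transform_eventually)
        then show ?thesis using top by (rule filterlim_compose)
      qed
      have "(\<lambda>n. flat 0 (real (Suc n) * (x - c) - 1) * flat 0 (real (Suc n) * (d - x) - 1))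
          \<longlonglongrightarrow> 1 * 1"
        using True by (intro tendsto_mult lim) auto
      then show ?thesis using True by (simp add: p_def algebra_simps)
    next
      case False
      then have "p n x = 0" for n
        using p_nonzero[of n x] zero_less_divide_1_iff[of "real (Suc n)"]
        unfolding greaterThanLessThan_iff by (cases "p n x = 0") linarith+
      then show ?thesis using False by simp
    qed
    have "(\<lambda>n. LINT x|lborel. F x * complex_of_real (p n x)) \<longlonglongrightarrow>
        (LINT x|lborel. F x * complex_of_real (indicator {c<..<d} x))"
    proof (rule integral_dominated_convergence)
      show "integrable lborel (\<lambda>x. norm (F x))" using F by simp
      show "(\<lambda>x. F x * complex_of_real (indicator {c<..<d} x)) \<in> borel_measurable lborel"
        using F by measurable
      show "(\<lambda>x. F x * complex_of_real (p n x)) \<in> borel_measurable lborel" for n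
        using F test_function_measurable[OF p[of n]] by measurable
      show "AE x in lborel. (\<lambda>n. F x * complex_of_real (p n x)) \<longlonglongrightarrow>
          F x * complex_of_real (indicator {c<..<d} x)"
        by (intro AE_I2 tendsto_mult tendsto_const tendsto_of_real p_lim)
      show "AE x in lborel. norm (F x * complex_of_real (p n x)) \<le> norm (F x)" for n
        using p_bound by (intro AE_I2) (simp add: norm_mult mult_left_le)
    qed
    then have "(LINT x|lborel. F x * complex_of_real (indicator {c<..<d} x)) = 0"
      using F_orth[OF p] by (simp add: LIMSEQ_const_iff)
    moreover have "F x * complex_of_real (indicator {c<..<d} x) = indicator {c<..<d} x *\<^sub>R F x" for x
      by (simp add: scaleR_conv_of_real mult.commute)
    ultimately show ?thesis by (simp add: set_lebesgue_integral_def)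
  qed
  have box: "(LINT x:box c d|lborel. F x) = 0" for c d :: real
  proof -
    have "(\<lambda>x. indicator {c<..<d} x *\<^sub>R F x) =
        (\<lambda>x. indicator {max c (left_end i)<..<min d (right_end i)} x *\<^sub>R F x)"
      by (auto simp: F_def indicator_def fun_eq_iff)
    then show ?thesis
      using ivl[of "max c (left_end i)" "min d (right_end i)"]
      unfolding set_lebesgue_integral_def box_real by simp
  qed
  have total: "(LINT x|lborel. F x) = 0"
  proof -
    have "indicator ?I x *\<^sub>R F x = F x" for x by (auto simp: F_def indicator_def)
    then show ?thesis using ivl[of "left_end i" "right_end i"] by (simp add: set_lebesgue_integral_def)
  qed
  have "(LINT x:A|lborel. F x) = 0" if "A \<in> sets lborel" for A
  proof -
    let ?G = "range (\<lambda>(a, b). box a b :: real set)"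
    have sets: "sigma_sets UNIV ?G = sets borel" by (simp add: borel_eq_box)
    have int: "set_integrable lborel A F" if "A \<in> sigma_sets UNIV ?G" for A
      using that F unfolding sets set_integrable_def by (intro integrable_mult_indicator) auto
    have "Int_stable ?G" by (auto simp: Int_stable_def box_Int_box)
    moreover have "?G \<subseteq> Pow UNIV" by simp
    moreover have "A \<in> sigma_sets UNIV ?G" using that sets by simp
    ultimately show ?thesis
    proof (induction rule: sigma_sets_induct_disjoint)
      case (basic A) then show ?case using box by auto
    next
      case empty show ?case by (simp add: set_lebesgue_integral_def)
    next
      case (compl A)
      have "(LINT x:UNIV - A|lborel. F x) = (LINT x|lborel. F x - indicator A x *\<^sub>R F x)"
        unfolding set_lebesgue_integral_def
        by (intro Bochner_Integration.integral_cong refl) (auto simp: indicator_def)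
      also have "\<dots> = (LINT x|lborel. F x) - (LINT x:A|lborel. F x)"
        unfolding set_lebesgue_integral_def
        using int[OF compl(1)] F by (intro Bochner_Integration.integral_diff) (auto simp: set_integrable_def)
      finally show ?case using compl total by simp
    next
      case (union A)
      have "set_integrable lborel (\<Union>k. A k) F"
        using union(2) F unfolding set_integrable_def sets by (intro integrable_mult_indicator) auto
      then have "(\<Sum>k. LINT x:A k|lborel. F x) = (LINT x:(\<Union>k. A k)|lborel. F x)"
        using union(1,2) unfolding sets
        by (intro lebesgue_integral_countable_add[symmetric]) (auto simp: disjoint_family_on_def)
      then show ?case using union(3) by simp
    qed
  qed
  then have "AE x in lborel. F x = 0" by (rule sigma_finite_measure.density_zero[OF sigma_finite_lborel F])
  then have "AE x in lborel. x \<in> ?I \<longrightarrow> f x = 0"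
    by (rule eventually_mono) (auto simp: F_def)
  then show ?thesis unfolding leb_def by (subst AE_restrict_space_iff) simp_all
qed

lift_definition weak_deriv :: "'i::bounded_interval L2 \<Rightarrow> 'i L2 \<Rightarrow> bool" is
  "\<lambda>f g. \<forall>p. test_function TYPE('i) p \<longrightarrow>
    (LINT x|leb TYPE('i). f x * complex_of_real (deriv p x)) =
    - (LINT x|leb TYPE('i). g x * complex_of_real (p x))"
  by (simp add: integral_test_cong[OF _ test_function_deriv] integral_test_cong)

lemma weak_deriv_zero: "weak_deriv 0 0"
  by transfer simp

lemma weak_deriv_add:
  "weak_deriv u u' \<Longrightarrow> weak_deriv v v' \<Longrightarrow> weak_deriv (u + v) (u' + v')"
  by transfer
    (simp add: l2_rel_refl_iff distrib_right Bochner_Integration.integral_add integrable_mult_test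
      test_function_deriv)

lemma weak_deriv_scaleC: "weak_deriv u u' \<Longrightarrow> weak_deriv (c *\<^sub>C u) (c *\<^sub>C u')"
  by transfer (simp add: mult.assoc)

lemma weak_deriv_scaleR: "weak_deriv u u' \<Longrightarrow> weak_deriv (r *\<^sub>R u) (r *\<^sub>R u')"
  using weak_deriv_scaleC[of u u' "complex_of_real r"] by (simp add: scaleC_of_real)

lemma weak_deriv_uminus: "weak_deriv u u' \<Longrightarrow> weak_deriv (- u) (- u')"
  using weak_deriv_scaleR[of u u' "-1"] by simp

lemma weak_deriv_diff:
  "weak_deriv u u' \<Longrightarrow> weak_deriv v v' \<Longrightarrow> weak_deriv (u - v) (u' - v')"
  using weak_deriv_add[of u u' "- v" "- v'"] weak_deriv_uminus[of v v'] by simp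

lemma weak_deriv_zero_imp_zero: "weak_deriv 0 g \<Longrightarrow> g = 0"
  by transfer (simp add: l2_rel_def AE_zero_if_orthogonal square_integrable_zero)

lemma weak_deriv_unique: "weak_deriv u g \<Longrightarrow> weak_deriv u h \<Longrightarrow> g = h"
  using weak_deriv_diff[of u g u h] weak_deriv_zero_imp_zero[of "g - h"] by simp

definition wD :: "'i::bounded_interval L2 \<Rightarrow> 'i L2" where
  "wD u = (THE g. weak_deriv u g)"

lemma wD_eq: "weak_deriv u g \<Longrightarrow> wD u = g"
  unfolding wD_def by (blast intro: weak_deriv_unique)


section \<open>Sobolev spaces and boundary values\<close>

definition H1_space :: "'i::bounded_interval L2 set" where
  "H1_space = {u. \<exists>g. weak_deriv u g}"

definition H2_space :: "'i::bounded_interval L2 set" where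
  "H2_space = {u \<in> H1_space. wD u \<in> H1_space}"

text \<open>The value at a point \<open>c\<close> of the closed interval of the continuous representative, which
  exists for \<open>u \<in> H1_space\<close>.\<close>

definition point_value :: "'i::bounded_interval L2 \<Rightarrow> real \<Rightarrow> complex" where
  "point_value u c = (THE y. \<exists>f. continuous_on {left_end TYPE('i)..right_end TYPE('i)} f \<and>
    (AE x in leb TYPE('i). rep_L2 u x = f x) \<and> f c = y)"

lemma weak_deriv_wD: "u \<in> H1_space \<Longrightarrow> weak_deriv u (wD u)"
  unfolding H1_space_def using wD_eq by blast

lemma H1_space_closed:
  assumes "u \<in> H1_space" "v \<in> H1_space"
  shows "u + v \<in> H1_space" "u - v \<in> H1_space" "- u \<in> H1_space" "r *\<^sub>R u \<in> H1_space"
    "c *\<^sub>C u \<in> H1_space"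
  using assms unfolding H1_space_def
  by (blast intro: weak_deriv_add weak_deriv_diff weak_deriv_uminus weak_deriv_scaleR
      weak_deriv_scaleC)+

lemma zero_in_H1_space: "0 \<in> H1_space"
  unfolding H1_space_def using weak_deriv_zero by blast

lemma wD_zero: "wD 0 = 0"
  by (rule wD_eq[OF weak_deriv_zero])

lemma wD_add: "u \<in> H1_space \<Longrightarrow> v \<in> H1_space \<Longrightarrow> wD (u + v) = wD u + wD v"
  by (intro wD_eq weak_deriv_add weak_deriv_wD)

lemma wD_scaleR: "u \<in> H1_space \<Longrightarrow> wD (r *\<^sub>R u) = r *\<^sub>R wD u"
  by (intro wD_eq weak_deriv_scaleR weak_deriv_wD)

lemma wD_scaleC: "u \<in> H1_space \<Longrightarrow> wD (c *\<^sub>C u) = c *\<^sub>C wD u"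
  by (intro wD_eq weak_deriv_scaleC weak_deriv_wD)

typedef (overloaded) 'i H1 = "H1_space :: 'i::bounded_interval L2 set"
  morphisms H1_to_L2 L2_to_H1
  using zero_in_H1_space by blast

setup_lifting type_definition_H1

instantiation H1 :: (bounded_interval) real_inner
begin

lift_definition zero_H1 :: "'a H1" is 0
  by (rule zero_in_H1_space)

lift_definition plus_H1 :: "'a H1 \<Rightarrow> 'a H1 \<Rightarrow> 'a H1" is "(+)"
  by (rule H1_space_closed)

lift_definition minus_H1 :: "'a H1 \<Rightarrow> 'a H1 \<Rightarrow> 'a H1" is "(-)"
  by (rule H1_space_closed)

lift_definition uminus_H1 :: "'a H1 \<Rightarrow> 'a H1" is uminus
  by (rule H1_space_closed)

lift_definition scaleR_H1 :: "real \<Rightarrow> 'a H1 \<Rightarrow> 'a H1" is scaleR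
  by (rule H1_space_closed)

lift_definition inner_H1 :: "'a H1 \<Rightarrow> 'a H1 \<Rightarrow> real" is
  "\<lambda>u v. u \<bullet> v + wD u \<bullet> wD v" .

definition norm_H1 :: "'a H1 \<Rightarrow> real" where "norm_H1 u = sqrt (u \<bullet> u)"

definition sgn_H1 :: "'a H1 \<Rightarrow> 'a H1" where "sgn_H1 u = inverse (norm u) *\<^sub>R u"

definition dist_H1 :: "'a H1 \<Rightarrow> 'a H1 \<Rightarrow> real" where "dist_H1 u v = norm (u - v)"

definition uniformity_H1 :: "('a H1 \<times> 'a H1) filter" where
  "uniformity_H1 = (INF e\<in>{0 <..}. principal {(x, y). dist x y < e})"

definition open_H1 :: "'a H1 set \<Rightarrow> bool" where
  "open_H1 U \<longleftrightarrow> (\<forall>x\<in>U. eventually (\<lambda>(x', y). x' = x \<longrightarrow> y \<in> U) uniformity)"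

instance
proof
  fix u v w :: "'a H1" and r s :: real
  show "u + v + w = u + (v + w)" by transfer (rule add.assoc)
  show "u + v = v + u" by transfer (rule add.commute)
  show "0 + u = u" by transfer simp
  show "- u + u = 0" by transfer simp
  show "u - v = u + - v" by transfer simp
  show "r *\<^sub>R (u + v) = r *\<^sub>R u + r *\<^sub>R v" by transfer (rule scaleR_add_right)
  show "(r + s) *\<^sub>R u = r *\<^sub>R u + s *\<^sub>R u" by transfer (rule scaleR_add_left)
  show "r *\<^sub>R s *\<^sub>R u = (r * s) *\<^sub>R u" by transfer simp
  show "1 *\<^sub>R u = u" by transfer simp
  show "u \<bullet> v = v \<bullet> u" by transfer (simp add: inner_commute)
  show "(u + v) \<bullet> w = u \<bullet> w + v \<bullet> w" by transfer (simp add: wD_add inner_add_left)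
  show "(r *\<^sub>R u) \<bullet> v = r * (u \<bullet> v)" by transfer (simp add: wD_scaleR distrib_left)
  show "0 \<le> u \<bullet> u" by transfer simp
  show "u \<bullet> u = 0 \<longleftrightarrow> u = 0"
    by transfer (simp add: add_nonneg_eq_0_iff, auto simp: wD_zero)
qed (rule norm_H1_def sgn_H1_def dist_H1_def uniformity_H1_def open_H1_def)+

end

instantiation H1 :: (bounded_interval) complex_normed_space
begin

lift_definition scaleC_H1 :: "complex \<Rightarrow> 'a H1 \<Rightarrow> 'a H1" is scaleC
  by (rule H1_space_closed)

instance
proof
  fix u v :: "'a H1" and b c :: complex and r :: real
  show "c *\<^sub>C (u + v) = c *\<^sub>C u + c *\<^sub>C v" by transfer (rule scaleC_add_right)
  show "(b + c) *\<^sub>C u = b *\<^sub>C u + c *\<^sub>C u" by transfer (rule scaleC_add_left)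
  show "b *\<^sub>C (c *\<^sub>C u) = (b * c) *\<^sub>C u" by transfer (rule scaleC_scaleC)
  show "complex_of_real r *\<^sub>C u = r *\<^sub>R u" by transfer (rule scaleC_of_real)
  have "(c *\<^sub>C u) \<bullet> (c *\<^sub>C u) = (cmod c)\<^sup>2 * (u \<bullet> u)"
    by transfer (simp add: wD_scaleC dot_square_norm norm_scaleC power_mult_distrib distrib_left)
  then show "norm (c *\<^sub>C u) = cmod c * norm u"
    by (simp add: norm_eq_sqrt_inner real_sqrt_mult)
qed

end


section \<open>The coupled wave-heat operator\<close>

datatype wave_ivl = Wave_Ivl

instantiation wave_ivl :: bounded_interval
begin
definition left_end_wave_ivl :: "wave_ivl itself \<Rightarrow> real" where "left_end_wave_ivl _ = -1"
definition right_end_wave_ivl :: "wave_ivl itself \<Rightarrow> real" where "right_end_wave_ivl _ = 0"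
instance by standard (simp add: left_end_wave_ivl_def right_end_wave_ivl_def)
end

datatype heat_ivl = Heat_Ivl

instantiation heat_ivl :: bounded_interval
begin
definition left_end_heat_ivl :: "heat_ivl itself \<Rightarrow> real" where "left_end_heat_ivl _ = 0"
definition right_end_heat_ivl :: "heat_ivl itself \<Rightarrow> real" where "right_end_heat_ivl _ = 1"
instance by standard (simp add: left_end_heat_ivl_def right_end_heat_ivl_def)
end

text \<open>The state space \<open>X = H\<^sup>1(-1,0) \<times> L\<^sup>2(-1,0) \<times> L\<^sup>2(0,1)\<close>; its norm is the product norm of
  the library, i.e. \<open>\<parallel>(u,v,w)\<parallel>\<^sup>2 = \<parallel>u\<parallel>\<^sup>2 + \<parallel>v\<parallel>\<^sup>2 + \<parallel>w\<parallel>\<^sup>2\<close>.\<close>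

type_synonym state = "wave_ivl H1 \<times> wave_ivl L2 \<times> heat_ivl L2"

definition Y_space :: "state set" where
  "Y_space = {(u, v, w). H1_to_L2 u \<in> H2_space \<and> v \<in> H1_space \<and> w \<in> H2_space}"

definition dom_A :: "state set" where
  "dom_A = {(u, v, w) \<in> Y_space.
    point_value (wD (H1_to_L2 u)) (-1) = 0 \<and> point_value w 1 = 0 \<and>
    point_value v 0 = point_value w 0 \<and>
    point_value (wD (H1_to_L2 u)) 0 = point_value (wD w) 0}"

definition op_A :: "state \<Rightarrow> state" where
  "op_A = (\<lambda>(u, v, w). (L2_to_H1 v, wD (wD (H1_to_L2 u)), wD (wD w)))"

end

theory Submission
  imports Defs
begin


text \<open>The operator is dissipative for the energy seminorm
\<open>\<parallel>u'\<parallel>\<^sup>2 + \<parallel>v\<parallel>\<^sup>2 + \<parallel>w\<parallel>\<^sup>2\<close>, and the only dissipation is that of the heat part. Let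
\<open>(is - A)(u,v,w) = (f,g,h)\<close>, and let \<open>X\<close> and \<open>Y\<close> be the energy seminorms of \<open>(u,v,w)\<close> and
\<open>(f,g,h)\<close>. Testing the three equations with \<open>u'\<close>, \<open>v\<close>, \<open>w\<close> makes the coupling terms at \<open>0\<close>
cancel and leaves \<open>\<parallel>w'\<parallel>\<^sup>2 \<le> Y X\<close>.

The wave part is controlled by its boundary data. Since \<open>s\<close> is real, the energy density
\<open>|u'(x)|\<^sup>2 + |v(x)|\<^sup>2\<close> varies with \<open>x\<close> only through \<open>f'\<close> and \<open>g\<close>, so that, up to \<open>O(Y X)\<close>, its integral
is at most its value at \<open>0\<close>, which by the coupling is \<open>|w'(0)|\<^sup>2 + |w(0)|\<^sup>2\<close>
(\<open>wave_estimates\<close>).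

The heat part bounds these boundary data by the dissipation (\<open>heat_estimates\<close>). The value \<open>w(0)\<close> is bounded
by \<open>\<parallel>w'\<parallel>\<close>. The flux \<open>w'(0)\<close> is where the rate is lost: a solution of \<open>w'' = isw\<close> looks like
\<open>exp (- sqrt (is) x)\<close> near \<open>0\<close>, for which \<open>|w'(0)|\<^sup>2\<close> is comparable to \<open>|s|\<^bsup>1/2\<^esup> \<parallel>w'\<parallel>\<^sup>2\<close>. In general,
interpolation and the imaginary part of the energy identity give
\<open>|w'(0)|\<^sup>2 \<le> C (|s|\<^bsup>1/2\<^esup> \<parallel>w'\<parallel>\<^sup>2 + \<parallel>h\<parallel>\<^sup>2)\<close> (\<open>boundary_flux_bound\<close>). Altogether
\<open>X\<^sup>2 \<le> C (|s|\<^bsup>1/2\<^esup> Y X + Y\<^sup>2)\<close>, hence \<open>X \<le> C |s|\<^bsup>1/2\<^esup> Y\<close> (\<open>energy_bound\<close>); the \<open>L\<^sup>2\<close> norm of \<open>u\<close> follows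
from \<open>isu = v + f\<close>.

This estimate also gives the existence of the resolvent. Particular solutions of both equations and
one homogeneous solution of each reduce \<open>(is - A)x = y\<close> to a linear system for two complex numbers, and
the estimate says that its matrix has trivial kernel (\<open>range_resolvent\<close>).

The analysis rests on one fact: an element of \<open>H\<^sup>1\<close> is a constant plus the primitive of its
weak derivative (\<open>H1_representation\<close>). The product rule for primitives is Fubini's theorem on a
triangle (\<open>primitive_mult\<close>), and it yields integration by parts as well as explicit solutions
of linear initial value problems.\<close>

section \<open>Primitives of integrable functions\<close>

lemma measurable_leb: "f \<in> borel_measurable borel \<Longrightarrow> f \<in> borel_measurable (leb i)"
  by (simp add: leb_def measurable_restrict_space1)

lemma indicator_atMost_measurable [measurable]: "{..x::real} \<inter> space (leb i) \<in> sets (leb i)"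
  unfolding leb_def by (simp add: sets_restrict_space space_restrict_space) (metis Int_commute atMost_borel imageI)

lemma AE_leb_iff: "(AE x in leb i. P x) \<longleftrightarrow> (AE x in lborel. x \<in> {left_end i<..<right_end i} \<longrightarrow> P x)"
  unfolding leb_def by (subst AE_restrict_space_iff) simp_all

lemma AE_leb_neq: "AE x in leb i. x \<noteq> c"
  unfolding AE_leb_iff by (rule eventually_mono[OF AE_lborel_singleton[of c]]) simp

lemma AE_leb_mem: "AE x in leb i. x \<in> {left_end i<..<right_end i}"
  unfolding AE_leb_iff by simp

lemma integral_leb:
  fixes f :: "real \<Rightarrow> 'a::{banach, second_countable_topology}"
  shows "(LINT x|leb i. f x) = (LINT x|lborel. indicator {left_end i<..<right_end i} x *\<^sub>R f x)"
  unfolding leb_def by (subst integral_restrict_space) auto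

lemma integrable_leb_continuous:
  fixes f :: "real \<Rightarrow> 'a::{banach, second_countable_topology}"
  assumes "continuous_on UNIV f"
  shows "integrable (leb i) f"
proof -
  have "integrable lborel (\<lambda>x. indicator {left_end i..right_end i} x *\<^sub>R f x)"
    by (rule borel_integrable_compact) (auto intro: continuous_on_subset[OF assms])
  then have "integrable lborel (\<lambda>x. indicator {left_end i<..<right_end i} x *\<^sub>R
      (indicator {left_end i..right_end i} x *\<^sub>R f x))"
    by (rule integrable_mult_indicator[rotated]) simp
  moreover have "indicator {left_end i<..<right_end i} x *\<^sub>R
      (indicator {left_end i..right_end i} x *\<^sub>R f x) = indicator {left_end i<..<right_end i} x *\<^sub>R f x" for x
    by (auto simp: indicator_def)
  ultimately have "integrable lborel (\<lambda>x. indicator {left_end i<..<right_end i} x *\<^sub>R f x)"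
    by (simp only:)
  then show ?thesis
    unfolding leb_def by (subst integrable_restrict_space) auto
qed

lemma square_integrable_continuous:
  assumes "continuous_on UNIV f"
  shows "square_integrable i f"
  unfolding square_integrable_def
  by (intro conjI measurable_leb borel_measurable_continuous_onI integrable_leb_continuous
      continuous_intros assms)

definition primitive :: "'i::bounded_interval itself \<Rightarrow> (real \<Rightarrow> complex) \<Rightarrow> real \<Rightarrow> complex" where
  "primitive i g x = (LINT y|leb i. indicator {..x} y *\<^sub>R g y)"

lemma integrable_truncate:
  fixes g :: "real \<Rightarrow> 'a::{banach, second_countable_topology}"
  shows "integrable (leb i) g \<Longrightarrow> integrable (leb i) (\<lambda>y. indicator {..x::real} y *\<^sub>R g y)"
proof -
  assume g: "integrable (leb i) g"
  have "integrable (leb i) (\<lambda>y. indicator ({..x} \<inter> space (leb i)) y *\<^sub>R g y)"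
    by (intro integrable_mult_indicator g) measurable
  then show ?thesis
    by (rule Bochner_Integration.integrable_cong[THEN iffD1, rotated 2]) (auto simp: indicator_def)
qed

lemma primitive_left: "primitive i g (left_end i) = 0"
proof -
  have "primitive i g (left_end i) = (LINT y|leb i. 0)"
    unfolding primitive_def
    by (rule Bochner_Integration.integral_cong)
      (auto simp: leb_def space_restrict_space indicator_def)
  then show ?thesis by simp
qed

lemma primitive_right: "primitive i g (right_end i) = (LINT y|leb i. g y)"
  unfolding primitive_def
  by (rule Bochner_Integration.integral_cong)
    (auto simp: leb_def space_restrict_space indicator_def)

lemma primitive_continuous:
  assumes g: "integrable (leb i) g"
  shows "continuous_on S (primitive i g)"
proof -
  have "(\<lambda>n. primitive i g (X n)) \<longlonglongrightarrow> primitive i g x" if X: "X \<longlonglongrightarrow> x" for X x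
    unfolding primitive_def
  proof (rule integral_dominated_convergence)
    show "integrable (leb i) (\<lambda>y. norm (g y))" using g by simp
    show "(\<lambda>y. indicator {..x} y *\<^sub>R g y) \<in> borel_measurable (leb i)"
      "(\<lambda>y. indicator {..X n} y *\<^sub>R g y) \<in> borel_measurable (leb i)" for n
      by (intro borel_measurable_integrable integrable_truncate g)+
    show "AE y in leb i. (\<lambda>n. indicator {..X n} y *\<^sub>R g y) \<longlonglongrightarrow> indicator {..x} y *\<^sub>R g y"
      using AE_leb_neq[of x]
    proof eventually_elim
      case (elim y)
      have "eventually (\<lambda>n. indicator {..X n} y *\<^sub>R g y = indicator {..x} y *\<^sub>R g y) sequentially"
      proof (cases "y < x")
        case True
        from order_tendstoD(1)[OF X True] show ?thesis
          by eventually_elim (use True in \<open>simp add: indicator_def\<close>)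
      next
        case False
        with elim have "x < y" by simp
        from order_tendstoD(2)[OF X this] show ?thesis
          by eventually_elim (use \<open>x < y\<close> in \<open>simp add: indicator_def\<close>)
      qed
      then show ?case by (rule tendsto_eventually)
    qed
    show "AE y in leb i. norm (indicator {..X n} y *\<^sub>R g y) \<le> norm (g y)" for n
      by (intro AE_I2) (simp add: indicator_def)
  qed
  then show ?thesis
    by (auto simp: continuous_on_sequentially comp_def)
qed

lemma primitive_add:
  "integrable (leb i) f \<Longrightarrow> integrable (leb i) g \<Longrightarrow> primitive i (\<lambda>x. f x + g x) x = primitive i f x + primitive i g x"
  unfolding primitive_def by (simp add: scaleR_add_right integrable_truncate)

lemma primitive_scale: "primitive i (\<lambda>x. c * f x) x = c * primitive i f x"
  unfolding primitive_def by (simp flip: mult_scaleR_right)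

lemma primitive_cnj: "primitive i (\<lambda>x. cnj (g x)) x = cnj (primitive i g x)"
proof -
  have "primitive i (\<lambda>x. cnj (g x)) x = (LINT y|leb i. cnj (indicator {..x} y *\<^sub>R g y))"
    unfolding primitive_def by (rule Bochner_Integration.integral_cong) (simp_all add: scaleR_conv_of_real)
  also have "\<dots> = cnj (primitive i g x)" unfolding primitive_def by (rule Bochner_Integration.integral_cnj)
  finally show ?thesis .
qed

lemma integrable_bounded_mult:
  fixes f h :: "real \<Rightarrow> complex"
  assumes f: "integrable (leb i) f" and h: "continuous_on UNIV h"
  shows "integrable (leb i) (\<lambda>x. f x * h x)"
proof -
  have "bounded (h ` {left_end i..right_end i})"
    by (intro compact_imp_bounded compact_continuous_image continuous_on_subset[OF h]) auto
  then obtain B where B: "\<And>x. x \<in> {left_end i..right_end i} \<Longrightarrow> cmod (h x) \<le> B"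
    unfolding bounded_iff by blast
  show ?thesis
  proof (rule Bochner_Integration.integrable_bound)
    show "integrable (leb i) (\<lambda>x. B * cmod (f x))" using f by simp
    have [measurable]: "h \<in> borel_measurable (leb i)"
      by (intro measurable_leb borel_measurable_continuous_onI h)
    note [measurable] = borel_measurable_integrable[OF f]
    show "(\<lambda>x. f x * h x) \<in> borel_measurable (leb i)" by measurable
    show "AE x in leb i. cmod (f x * h x) \<le> norm (B * cmod (f x))"
      using AE_leb_mem
    proof eventually_elim
      case (elim x)
      then have "cmod (h x) \<le> B" by (intro B) simp
      moreover from this have "0 \<le> B" using norm_ge_zero[of "h x"] by linarith
      ultimately show ?case
        by (simp add: norm_mult abs_mult mult.commute[of "cmod (f x)"] mult_right_mono)
    qed
  qed
qed

text \<open>The product rule for absolutely continuous functions, in integrated form. The product of the two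
integrals is the integral of \<open>f y * g z\<close> over a square, and the diagonal cuts the square into the
triangles \<open>z \<le> y\<close> and \<open>y < z\<close>; integrating over each of them first in the smaller variable gives
the two terms on the right.\<close>

lemma primitive_mult:
  assumes f: "integrable (leb i) f" and g: "integrable (leb i) g"
  shows "primitive i f x * primitive i g x = primitive i (\<lambda>y. f y * primitive i g y + primitive i f y * g y) x"
proof -
  let ?M = "leb i"
  interpret finite_measure ?M by (rule finite_measure_leb)
  interpret P: pair_sigma_finite ?M ?M ..
  define f' where "f' y = indicator {..x} y *\<^sub>R f y" for y
  define g' where "g' y = indicator {..x} y *\<^sub>R g y" for y
  have f': "integrable ?M f'" and g': "integrable ?M g'"
    unfolding f'_def g'_def by (intro integrable_truncate f g)+
  note [measurable] = borel_measurable_integrable[OF f'] borel_measurable_integrable[OF g']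
  \<comment> \<open>The integrand on the square, and its parts on the two triangles.\<close>
  let ?H = "\<lambda>(y, z). f' y * g' z"
  let ?T = "\<lambda>(y, z). indicator {..y} z *\<^sub>R (f' y * g' z)"
  let ?U = "\<lambda>(y, z). indicator {..<z} y *\<^sub>R (f' y * g' z)"
  have H: "integrable (?M \<Otimes>\<^sub>M ?M) ?H"
    by (rule P.Fubini_integrable) (use f' g' in \<open>auto simp: norm_mult\<close>)
  have fst_m[measurable]: "fst \<in> borel_measurable (?M \<Otimes>\<^sub>M ?M)"
    and snd_m[measurable]: "snd \<in> borel_measurable (?M \<Otimes>\<^sub>M ?M)"
    using measurable_compose[OF measurable_fst measurable_leb[OF measurable_ident]]
      measurable_compose[OF measurable_snd measurable_leb[OF measurable_ident]] by (simp_all add: id_def)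
  have T: "integrable (?M \<Otimes>\<^sub>M ?M) ?T"
  proof (rule Bochner_Integration.integrable_bound[OF H])
    have "?T = (\<lambda>p. if snd p \<le> fst p then f' (fst p) * g' (snd p) else 0)"
      by (auto simp: indicator_def fun_eq_iff)
    also have "\<dots> \<in> borel_measurable (?M \<Otimes>\<^sub>M ?M)" by measurable
    finally show "?T \<in> borel_measurable (?M \<Otimes>\<^sub>M ?M)" .
  qed (auto simp: indicator_def)
  have U: "integrable (?M \<Otimes>\<^sub>M ?M) ?U"
  proof (rule Bochner_Integration.integrable_bound[OF H])
    have "?U = (\<lambda>p. if fst p < snd p then f' (fst p) * g' (snd p) else 0)"
      by (auto simp: indicator_def fun_eq_iff)
    also have "\<dots> \<in> borel_measurable (?M \<Otimes>\<^sub>M ?M)" by measurable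
    finally show "?U \<in> borel_measurable (?M \<Otimes>\<^sub>M ?M)" .
  qed (auto simp: indicator_def)
  have "primitive i f x * primitive i g x = (LINT y|?M. LINT z|?M. f' y * g' z)"
    unfolding primitive_def f'_def[symmetric] g'_def[symmetric] by simp
  also have "\<dots> = integral\<^sup>L (?M \<Otimes>\<^sub>M ?M) ?H"
    by (rule P.integral_fst) (rule H)
  also have "\<dots> = integral\<^sup>L (?M \<Otimes>\<^sub>M ?M) (\<lambda>p. ?T p + ?U p)"
    by (rule Bochner_Integration.integral_cong) (auto simp: indicator_def)
  also have "\<dots> = integral\<^sup>L (?M \<Otimes>\<^sub>M ?M) ?T + integral\<^sup>L (?M \<Otimes>\<^sub>M ?M) ?U"
    by (rule Bochner_Integration.integral_add[OF T U])
  also have "integral\<^sup>L (?M \<Otimes>\<^sub>M ?M) ?T = (LINT y|?M. LINT z|?M. indicator {..y} z *\<^sub>R (f' y * g' z))"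
    by (rule P.integral_fst[symmetric]) (rule T)
  also have "\<dots> = (LINT y|?M. indicator {..x} y *\<^sub>R (f y * primitive i g y))"
  proof (rule Bochner_Integration.integral_cong)
    fix y assume "y \<in> space ?M"
    have "(LINT z|?M. indicator {..y} z *\<^sub>R (f' y * g' z)) =
        (LINT z|?M. f' y * (indicator {..y} z *\<^sub>R g z))"
      by (rule Bochner_Integration.integral_cong) (auto simp: f'_def g'_def indicator_def)
    also have "\<dots> = f' y * primitive i g y" unfolding primitive_def by (rule integral_mult_right_zero)
    finally show "(LINT z|?M. indicator {..y} z *\<^sub>R (f' y * g' z)) = indicator {..x} y *\<^sub>R (f y * primitive i g y)"
      by (simp add: f'_def)
  qed simp
  also have "integral\<^sup>L (?M \<Otimes>\<^sub>M ?M) ?U = (LINT z|?M. LINT y|?M. indicator {..<z} y *\<^sub>R (f' y * g' z))"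
    by (rule P.integral_snd[symmetric]) (rule U)
  also have "\<dots> = (LINT z|?M. indicator {..x} z *\<^sub>R (primitive i f z * g z))"
  proof (rule Bochner_Integration.integral_cong)
    fix z assume "z \<in> space ?M"
    have "(LINT y|?M. indicator {..<z} y *\<^sub>R (f' y * g' z)) =
        (LINT y|?M. (indicator {..z} y *\<^sub>R f y) * g' z)"
    proof (rule integral_cong_AE)
      have "(\<lambda>y. indicator {..<z} y *\<^sub>R (f' y * g' z)) = (\<lambda>y. if y < z then f' y * g' z else 0)"
        by (auto simp: indicator_def fun_eq_iff)
      moreover have "(\<lambda>y. y) \<in> borel_measurable ?M" by (intro measurable_leb) simp
      ultimately show "(\<lambda>y. indicator {..<z} y *\<^sub>R (f' y * g' z)) \<in> borel_measurable ?M" by simp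
      show "(\<lambda>y. (indicator {..z} y *\<^sub>R f y) * g' z) \<in> borel_measurable ?M"
        using borel_measurable_integrable[OF integrable_truncate[OF f, of z]] by measurable
      show "AE y in ?M. indicator {..<z} y *\<^sub>R (f' y * g' z) = (indicator {..z} y *\<^sub>R f y) * g' z"
        using AE_leb_neq[of z] by eventually_elim (auto simp: f'_def g'_def indicator_def)
    qed
    also have "\<dots> = primitive i f z * g' z" unfolding primitive_def by (rule integral_mult_left_zero)
    finally show "(LINT y|?M. indicator {..<z} y *\<^sub>R (f' y * g' z)) = indicator {..x} z *\<^sub>R (primitive i f z * g z)"
      by (simp add: g'_def)
  qed simp
  also have "(LINT y|?M. indicator {..x} y *\<^sub>R (f y * primitive i g y)) +
      (LINT y|?M. indicator {..x} y *\<^sub>R (primitive i f y * g y)) =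
      primitive i (\<lambda>y. f y * primitive i g y + primitive i f y * g y) x"
    unfolding primitive_def[of _ _ x]
    by (simp add: scaleR_add_right integrable_truncate integrable_bounded_mult f g primitive_continuous
        mult.commute[of "primitive i f _"])
  finally show ?thesis .
qed

lemma primitive_deriv:
  assumes q: "\<And>x. (q has_vector_derivative q' x) (at x)" and q': "continuous_on UNIV q'"
    and x: "left_end i \<le> x" "x \<le> right_end i"
  shows "primitive i q' x = q x - q (left_end i)"
proof -
  have "primitive i q' x = (LINT y|lborel. indicator {left_end i<..<right_end i} y *\<^sub>R indicator {..x} y *\<^sub>R q' y)"
    unfolding primitive_def integral_leb by simp
  also have "\<dots> = (LINT y|lborel. indicator {left_end i..x} y *\<^sub>R q' y)"
  proof (rule integral_cong_AE)
    have [measurable]: "q' \<in> borel_measurable borel" by (rule borel_measurable_continuous_onI[OF q'])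
    show "(\<lambda>y. indicator {left_end i<..<right_end i} y *\<^sub>R indicator {..x} y *\<^sub>R q' y) \<in> borel_measurable lborel"
      "(\<lambda>y. indicator {left_end i..x} y *\<^sub>R q' y) \<in> borel_measurable lborel" by measurable
    show "AE y in lborel. indicator {left_end i<..<right_end i} y *\<^sub>R indicator {..x} y *\<^sub>R q' y
        = indicator {left_end i..x} y *\<^sub>R q' y"
      using AE_lborel_singleton[of "left_end i"] AE_lborel_singleton[of "right_end i"]
      by eventually_elim (use x in \<open>auto simp: indicator_def\<close>)
  qed
  also have "\<dots> = q x - q (left_end i)"
    by (rule integral_FTC_Icc)
      (use x q in \<open>auto intro: continuous_on_subset[OF q'] has_vector_derivative_at_within\<close>)
  finally show ?thesis .
qed


section \<open>Weak derivatives of primitives\<close>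

lemma abs_L2_eq_iff:
  assumes "square_integrable TYPE('i::bounded_interval) f" "square_integrable TYPE('i) g"
  shows "(abs_L2 f :: 'i L2) = abs_L2 g \<longleftrightarrow> (AE x in leb TYPE('i). f x = g x)"
proof -
  have Q: "Quotient (l2_rel TYPE('i)) abs_L2 rep_L2 (represents_L2 :: _ \<Rightarrow> 'i L2 \<Rightarrow> bool)"
    by (rule Quotient_L2)
  have "l2_rel TYPE('i) f g \<longleftrightarrow> (abs_L2 f :: 'i L2) = abs_L2 g"
    using Quotient_rel[OF Q, of f g] assms by (simp add: l2_rel_refl_iff)
  with assms show ?thesis by (simp add: l2_rel_def)
qed

lemma abs_L2_cases:
  fixes u :: "'i::bounded_interval L2"
  obtains f where "square_integrable TYPE('i) f" "u = abs_L2 f"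
  using rep_L2[of u] by metis

lemma rep_abs_L2:
  assumes "square_integrable TYPE('i::bounded_interval) f"
  shows "AE x in leb TYPE('i). rep_L2 (abs_L2 f :: 'i L2) x = f x"
  using abs_L2_eq_iff[OF rep_L2(1)[of "abs_L2 f :: 'i L2"] assms] rep_L2(2) by blast

lemma abs_L2_ops:
  assumes "square_integrable TYPE('i::bounded_interval) f" "square_integrable TYPE('i) g"
  shows "(abs_L2 f :: 'i L2) + abs_L2 g = abs_L2 (\<lambda>x. f x + g x)"
    and "(abs_L2 f :: 'i L2) - abs_L2 g = abs_L2 (\<lambda>x. f x - g x)"
    and "c *\<^sub>C (abs_L2 f :: 'i L2) = abs_L2 (\<lambda>x. c * f x)"
    and "(abs_L2 f :: 'i L2) \<bullet> abs_L2 g = (LINT x|leb TYPE('i). f x \<bullet> g x)"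
  using assms
  by (simp_all add: plus_L2.abs_eq minus_L2.abs_eq scaleC_L2.abs_eq inner_L2.abs_eq l2_rel_refl_iff)

lemma zero_L2_abs: "(0 :: 'i::bounded_interval L2) = abs_L2 (\<lambda>_. 0)"
  by (simp add: zero_L2_def)

lemma weak_deriv_abs:
  assumes "square_integrable TYPE('i::bounded_interval) f" "square_integrable TYPE('i) g"
  shows "weak_deriv (abs_L2 f :: 'i L2) (abs_L2 g) \<longleftrightarrow> (\<forall>p. test_function TYPE('i) p \<longrightarrow>
    (LINT x|leb TYPE('i). f x * complex_of_real (deriv p x)) =
    - (LINT x|leb TYPE('i). g x * complex_of_real (p x)))"
  using assms by (simp add: weak_deriv.abs_eq l2_rel_refl_iff)

lemma test_function_derivative:
  assumes "test_function i p"
  shows "((\<lambda>x. complex_of_real (p x)) has_vector_derivative complex_of_real (deriv p x)) (at x)"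
proof -
  have "(deriv ^^ 0) p differentiable (at x)"
    using assms unfolding test_function_def smooth_def by blast
  then have "(p has_real_derivative deriv p x) (at x)"
    by (simp add: DERIV_deriv_iff_real_differentiable)
  then show ?thesis
    by (intro has_vector_derivative_of_real) (simp add: has_real_derivative_iff_has_vector_derivative)
qed

lemma test_function_ends:
  assumes "test_function i p" shows "p (left_end i) = 0" "p (right_end i) = 0"
  using assms unfolding test_function_def by auto

text \<open>Primitives obey integration by parts against smooth functions vanishing at the ends: this is
\<open>primitive_mult\<close> at the right end point, where the product of the primitives is \<open>0\<close>.\<close>

lemma integral_primitive_mult_deriv:
  assumes lr: "left_end i < right_end i" and g: "integrable (leb i) g"
    and q: "\<And>x. (q has_vector_derivative q' x) (at x)" and q': "continuous_on UNIV q'"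
    and ends: "q (left_end i) = 0" "q (right_end i) = 0"
  shows "(LINT x|leb i. q' x * (c + primitive i g x)) = - (LINT x|leb i. q x * g x)"
proof -
  have le: "left_end i \<le> right_end i" using lr by simp
  have qc: "continuous_on UNIV q"
    using q by (meson continuous_at_imp_continuous_on has_vector_derivative_continuous)
  have q'i: "integrable (leb i) q'" by (rule integrable_leb_continuous[OF q'])
  have Pq: "primitive i q' x = q x" if "x \<in> {left_end i..right_end i}" for x
    using primitive_deriv[OF q q', of i x] that ends by simp
  have i1: "integrable (leb i) (\<lambda>x. q' x * primitive i g x)"
    by (rule integrable_bounded_mult[OF q'i primitive_continuous[OF g]])
  have i2: "integrable (leb i) (\<lambda>x. q x * g x)"
    using integrable_bounded_mult[OF g qc] by (simp add: mult.commute)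
  have "0 = primitive i q' (right_end i) * primitive i g (right_end i)"
    using Pq[of "right_end i"] ends le by simp
  also have "\<dots> = (LINT x|leb i. q' x * primitive i g x + primitive i q' x * g x)"
    unfolding primitive_mult[OF q'i g] by (rule primitive_right)
  also have "\<dots> = (LINT x|leb i. q' x * primitive i g x + q x * g x)"
    by (rule Bochner_Integration.integral_cong)
      (auto simp: Pq leb_def space_restrict_space)
  also have "\<dots> = (LINT x|leb i. q' x * primitive i g x) + (LINT x|leb i. q x * g x)"
    by (rule Bochner_Integration.integral_add[OF i1 i2])
  finally have 1: "(LINT x|leb i. q' x * primitive i g x) = - (LINT x|leb i. q x * g x)"
    by (simp add: eq_neg_iff_add_eq_0)
  have 2: "(LINT x|leb i. q' x * c) = 0"
    using Pq[of "right_end i"] ends le by (simp add: primitive_right)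
  have "(LINT x|leb i. q' x * (c + primitive i g x)) = (LINT x|leb i. q' x * c) + (LINT x|leb i. q' x * primitive i g x)"
    unfolding distrib_left by (rule Bochner_Integration.integral_add[OF _ i1]) (simp add: q'i)
  with 1 2 show ?thesis by simp
qed

lemma square_integrable_mult_continuous:
  assumes f: "square_integrable i f" and h: "continuous_on UNIV h"
  shows "square_integrable i (\<lambda>x. h x * f x)"
proof -
  note [measurable] = f[unfolded square_integrable_def, THEN conjunct1]
  have [measurable]: "h \<in> borel_measurable (leb i)"
    by (intro measurable_leb borel_measurable_continuous_onI h)
  have "integrable (leb i) (\<lambda>x. complex_of_real ((cmod (f x))\<^sup>2) * (complex_of_real ((cmod (h x))\<^sup>2)))"
    using f unfolding square_integrable_def
    by (intro integrable_bounded_mult continuous_intros h integrable_of_real) auto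
  then have "integrable (leb i) (\<lambda>x. complex_of_real ((cmod (h x * f x))\<^sup>2))"
    by (simp add: norm_mult power_mult_distrib mult.commute)
  then have "integrable (leb i) (\<lambda>x. (cmod (h x * f x))\<^sup>2)"
    by (simp only: complex_of_real_integrable_eq)
  then show ?thesis unfolding square_integrable_def by simp
qed

text \<open>The factor \<open>h\<close> is moved to the test function \<open>p\<close>, whose product with \<open>h\<close> need be neither real
nor infinitely smooth but still vanishes at the ends. With \<open>h = 1\<close> this differentiates
primitives; with an exponential \<open>h\<close> it verifies the variation of constants formula.\<close>

lemma weak_deriv_mult_primitive:
  fixes g :: "real \<Rightarrow> complex"
  assumes g: "square_integrable TYPE('i::bounded_interval) g"
    and h: "\<And>x. (h has_vector_derivative h' x) (at x)" and h': "continuous_on UNIV h'"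
  shows "weak_deriv (abs_L2 (\<lambda>x. h x * (c + primitive TYPE('i) g x)) :: 'i L2)
    (abs_L2 (\<lambda>x. h' x * (c + primitive TYPE('i) g x) + h x * g x))"
proof -
  let ?i = "TYPE('i)"
  let ?z = "\<lambda>x. c + primitive ?i g x"
  have gi: "integrable (leb ?i) g" by (rule square_integrable_integrable[OF g])
  have hc: "continuous_on UNIV h"
    using h by (meson continuous_at_imp_continuous_on has_vector_derivative_continuous)
  have zc: "continuous_on UNIV ?z" by (intro continuous_intros primitive_continuous gi)
  have s1: "square_integrable ?i (\<lambda>x. h x * ?z x)"
    by (intro square_integrable_continuous continuous_intros hc primitive_continuous gi)
  have s2: "square_integrable ?i (\<lambda>x. h' x * ?z x)"
    by (intro square_integrable_continuous continuous_intros h' primitive_continuous gi)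
  have s3: "square_integrable ?i (\<lambda>x. h x * g x)"
    by (rule square_integrable_mult_continuous[OF g hc])
  show ?thesis
    unfolding weak_deriv_abs[OF s1 square_integrable_add[OF s2 s3]]
  proof (intro allI impI)
    fix p assume p: "test_function ?i p"
    let ?p = "\<lambda>x. complex_of_real (p x)" and ?p' = "\<lambda>x. complex_of_real (deriv p x)"
    have cp: "continuous_on UNIV ?p" "continuous_on UNIV ?p'"
      by (intro continuous_intros test_function_continuous[OF p]
          test_function_continuous[OF test_function_deriv[OF p]])+
    let ?q' = "\<lambda>x. h x * ?p' x + h' x * ?p x"
    have "(LINT x|leb ?i. ?q' x * ?z x) = - (LINT x|leb ?i. (h x * ?p x) * g x)"
      by (rule integral_primitive_mult_deriv[OF left_less_right gi])
        (use test_function_ends[OF p] in \<open>auto intro!: has_vector_derivative_mult h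
          test_function_derivative[OF p] continuous_intros hc h' cp\<close>)
    moreover have "(LINT x|leb ?i. ?q' x * ?z x) =
        (LINT x|leb ?i. h x * ?z x * ?p' x) + (LINT x|leb ?i. h' x * ?z x * ?p x)"
    proof -
      have "integrable (leb ?i) (\<lambda>x. h x * ?z x * ?p' x)" "integrable (leb ?i) (\<lambda>x. h' x * ?z x * ?p x)"
        by (intro integrable_leb_continuous continuous_intros hc h' cp primitive_continuous gi)+
      note Bochner_Integration.integral_add[OF this]
      moreover have "?q' x * ?z x = h x * ?z x * ?p' x + h' x * ?z x * ?p x" for x
        by (simp add: algebra_simps)
      ultimately show ?thesis by (simp only:)
    qed
    moreover have "(LINT x|leb ?i. (h' x * ?z x + h x * g x) * ?p x) =
        (LINT x|leb ?i. h' x * ?z x * ?p x) + (LINT x|leb ?i. (h x * ?p x) * g x)"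
    proof -
      have "integrable (leb ?i) (\<lambda>x. h' x * ?z x * ?p x)" "integrable (leb ?i) (\<lambda>x. h x * g x * ?p x)"
        by (intro integrable_mult_test[OF _ p] s2 s3)+
      note Bochner_Integration.integral_add[OF this]
      moreover have "(h' x * ?z x + h x * g x) * ?p x = h' x * ?z x * ?p x + h x * g x * ?p x" for x
        by (simp add: algebra_simps)
      moreover have "h x * g x * ?p x = (h x * ?p x) * g x" for x by (simp add: algebra_simps)
      ultimately show ?thesis by (simp only:)
    qed
    ultimately show "(LINT x|leb ?i. h x * ?z x * ?p' x) = - (LINT x|leb ?i. (h' x * ?z x + h x * g x) * ?p x)"
      by (simp add: algebra_simps add_eq_0_iff)
  qed
qed

section \<open>Functions with vanishing weak derivative\<close>

lemma smooth_lincomb: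
  assumes p: "smooth p" and q: "smooth q"
  shows "smooth (\<lambda>x. p x + m * q x)"
proof -
  have d: "((deriv ^^ k) f has_real_derivative (deriv ^^ Suc k) f x) (at x)" if "smooth f" for f k x
    using that unfolding smooth_def by (simp add: DERIV_deriv_iff_real_differentiable)
  have eq: "(deriv ^^ k) (\<lambda>x. p x + m * q x) = (\<lambda>x. (deriv ^^ k) p x + m * (deriv ^^ k) q x)" for k
  proof (induction k)
    case (Suc k)
    have "((\<lambda>x. (deriv ^^ k) p x + m * (deriv ^^ k) q x) has_real_derivative
        (deriv ^^ Suc k) p x + m * (deriv ^^ Suc k) q x) (at x)" for x
      by (intro DERIV_add DERIV_cmult d p q)
    then show ?case using Suc.IH by (auto intro!: DERIV_imp_deriv)
  qed simp
  have "((deriv ^^ k) (\<lambda>x. p x + m * q x) has_real_derivative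
        (deriv ^^ Suc k) p x + m * (deriv ^^ Suc k) q x) (at x)" for k x
    unfolding eq by (intro DERIV_add DERIV_cmult d p q)
  then show ?thesis unfolding smooth_def real_differentiable_def by blast
qed

lemma test_function_lincomb:
  assumes p: "test_function i p" and q: "test_function i q"
  shows "test_function i (\<lambda>x. p x + m * q x)"
proof -
  obtain c d c' d' where "left_end i < c" "d < right_end i" "\<And>x. x \<notin> {c..d} \<Longrightarrow> p x = 0"
      "left_end i < c'" "d' < right_end i" "\<And>x. x \<notin> {c'..d'} \<Longrightarrow> q x = 0"
    using assms unfolding test_function_def by metis
  then have "left_end i < min c c'" "max d d' < right_end i"
    "\<forall>x. x \<notin> {min c c'..max d d'} \<longrightarrow> p x + m * q x = 0"
    by (auto simp: le_max_iff_disj min_le_iff_disj)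
  moreover have "smooth (\<lambda>x. p x + m * q x)"
    using assms smooth_lincomb unfolding test_function_def by blast
  ultimately show ?thesis unfolding test_function_def by blast
qed

lemma test_function_integrable: "test_function i p \<Longrightarrow> integrable (leb i) p"
  by (intro integrable_leb_continuous test_function_continuous)

lemma zero_derivative_const:
  fixes q :: "real \<Rightarrow> real"
  assumes "\<And>t. (q has_real_derivative r t) (at t)" and "\<And>t. x < t \<Longrightarrow> t < y \<Longrightarrow> r t = 0" and "x \<le> y"
  shows "q x = q y"
proof (cases "x = y")
  case False
  then have "x < y" using assms by simp
  from MVT2[OF this, of q r] assms(1) obtain z where "x < z" "z < y" "q y - q x = (y - x) * r z"
    by blast
  with assms(2)[of z] show ?thesis by simp
qed simp

text \<open>The antiderivative that vanishes at the left end point is \<open>0\<close> to the left of the support of \<open>p\<close>;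
mean zero makes it vanish to the right of the support too.\<close>

lemma test_function_antiderivative:
  assumes le: "left_end i < right_end i" and p: "test_function i p" and int: "(LINT x|leb i. p x) = 0"
  obtains q where "test_function i q" "deriv q = p"
proof -
  obtain c d where cd: "left_end i < c" "d < right_end i" "\<And>x. x \<notin> {c..d} \<Longrightarrow> p x = 0"
    using p unfolding test_function_def by blast
  have "\<And>x. isCont p x"
    using test_function_continuous[OF p, of UNIV] by (simp add: continuous_on_eq_continuous_at)
  then obtain F where F: "\<And>x. (F has_vector_derivative p x) (at x)"
    using einterval_antiderivative[of "-\<infinity>" "\<infinity>" p] by auto
  define q where "q x = F x - F (left_end i)" for x
  have q: "(q has_real_derivative p x) (at x)" for x
    using F[of x] unfolding q_def
    by (auto intro!: derivative_eq_intros simp: has_real_derivative_iff_has_vector_derivative)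
  then have dq: "deriv q = p" by (auto intro!: DERIV_imp_deriv)
  have "complex_of_real (q (right_end i)) = 0"
  proof -
    have "((\<lambda>x. complex_of_real (q x)) has_vector_derivative complex_of_real (p x)) (at x)" for x
      by (intro has_vector_derivative_of_real)
        (use q in \<open>simp add: has_real_derivative_iff_has_vector_derivative\<close>)
    from primitive_deriv[OF this, of i "right_end i"]
    have "primitive i (\<lambda>x. complex_of_real (p x)) (right_end i) = complex_of_real (q (right_end i)) - complex_of_real (q (left_end i))"
      using le by (auto intro!: continuous_intros test_function_continuous[OF p])
    then show ?thesis using int by (simp add: primitive_right q_def)
  qed
  then have qb: "q (right_end i) = 0" by simp
  have qa: "q (left_end i) = 0" by (simp add: q_def)
  have out: "q x = 0" if x: "x \<notin> {c..d}" for x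
  proof -
    have p0: "p t = 0" if "t < c \<or> d < t" for t by (rule cd(3)) (use that in auto)
    consider "x < c" | "d < x" using x by force
    then show ?thesis
    proof cases
      case 1
      \<comment> \<open>\<open>min\<close> and \<open>max\<close> cover both orders of \<open>x\<close> and the end point.\<close>
      have "q (min x (left_end i)) = q (max x (left_end i))"
        by (rule zero_derivative_const[OF q]) (use 1 cd(1,2) in \<open>auto intro!: p0 simp: less_max_iff_disj\<close>)
      then show ?thesis using qa by (simp add: min_def max_def split: if_splits)
    next
      case 2
      have "q (min x (right_end i)) = q (max x (right_end i))"
        by (rule zero_derivative_const[OF q]) (use 2 cd(1,2) in \<open>auto intro!: p0 simp: min_less_iff_disj\<close>)
      then show ?thesis using qb by (simp add: min_def max_def split: if_splits)
    qed
  qed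
  have "smooth q"
    unfolding smooth_def
  proof (intro allI)
    fix k x
    show "(deriv ^^ k) q differentiable (at x)"
    proof (cases k)
      case 0
      then show ?thesis using q by (auto simp: real_differentiable_def)
    next
      case (Suc j)
      then have "(deriv ^^ k) q = (deriv ^^ j) p" by (simp only: funpow_Suc_right comp_apply dq)
      then show ?thesis using p unfolding test_function_def smooth_def by simp
    qed
  qed
  with cd out have "test_function i q" unfolding test_function_def by blast
  then show thesis using dq by (rule that)
qed

text \<open>Subtracting from a test function the multiple of a fixed one \<open>p0\<close> that has the same integral leaves
a test function of mean zero, that is, a derivative. Hence \<open>f\<close> acts on every test function like the
constant that is the \<open>p0\<close>-average of \<open>f\<close>.\<close>

lemma weak_deriv_zero_imp_const:
  assumes "weak_deriv (u :: 'i::bounded_interval L2) 0"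
  obtains c where "u = abs_L2 (\<lambda>_. c)"
proof -
  let ?i = "TYPE('i)"
  obtain f where f: "square_integrable ?i f" and u: "u = abs_L2 f" by (rule abs_L2_cases)
  have orth: "(LINT x|leb ?i. f x * complex_of_real (deriv p x)) = 0" if "test_function ?i p" for p
    using assms that unfolding u zero_L2_abs weak_deriv_abs[OF f square_integrable_zero] by simp
  have "\<exists>p. test_function ?i p \<and> (LINT x|leb ?i. p x) \<noteq> 0"
  proof (rule ccontr)
    assume "\<not> ?thesis"
    then have "(LINT x|leb ?i. 1 * complex_of_real (p x)) = 0" if "test_function ?i p" for p
      using that by simp
    then have "AE x in leb ?i. (1::complex) = 0"
      by (intro AE_zero_if_orthogonal square_integrable_continuous) auto
    then have "AE x in lborel. x \<notin> {left_end ?i<..<right_end ?i}" by (simp add: AE_leb_iff)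
    then have "emeasure lborel {x. left_end ?i < x \<and> x < right_end ?i} = 0"
      by (subst (asm) AE_iff_measurable[OF _ refl]) auto
    moreover have "{x. left_end ?i < x \<and> x < right_end ?i} = {left_end ?i<..<right_end ?i}" by auto
    ultimately have "emeasure lborel {left_end ?i<..<right_end ?i} = 0" by simp
    then show False using left_less_right[where 'a='i] by simp
  qed
  then obtain p0 where p0: "test_function ?i p0" and m0: "(LINT x|leb ?i. p0 x) \<noteq> 0" by blast
  define c where "c = (LINT x|leb ?i. f x * complex_of_real (p0 x)) / complex_of_real (LINT x|leb ?i. p0 x)"
  have "AE x in leb ?i. f x - c = 0"
  proof (rule AE_zero_if_orthogonal)
    show "square_integrable ?i (\<lambda>x. f x - c)"
      by (intro square_integrable_diff f square_integrable_continuous continuous_intros)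
    fix p assume p: "test_function ?i p"
    define m where "m = - (LINT x|leb ?i. p x) / (LINT x|leb ?i. p0 x)"
    have t: "test_function ?i (\<lambda>x. p x + m * p0 x)" by (rule test_function_lincomb[OF p p0])
    have "(LINT x|leb ?i. p x + m * p0 x) = 0"
      using m0 by (simp add: test_function_integrable p p0 m_def)
    then obtain q where q: "test_function ?i q" "deriv q = (\<lambda>x. p x + m * p0 x)"
      using test_function_antiderivative[OF left_less_right t] by blast
    note i = integrable_mult_test[OF f p] integrable_mult_test[OF f p0]
    have "0 = (LINT x|leb ?i. f x * complex_of_real (p x + m * p0 x))"
      using orth[OF q(1)] q(2) by simp
    also have "\<dots> = (LINT x|leb ?i. f x * complex_of_real (p x) + complex_of_real m * (f x * complex_of_real (p0 x)))"
      by (rule Bochner_Integration.integral_cong) (simp_all add: algebra_simps)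
    also have "\<dots> = (LINT x|leb ?i. f x * complex_of_real (p x)) + complex_of_real m * (LINT x|leb ?i. f x * complex_of_real (p0 x))"
      using i by simp
    also have "complex_of_real m * (LINT x|leb ?i. f x * complex_of_real (p0 x)) = - c * complex_of_real (LINT x|leb ?i. p x)"
      using m0 by (simp add: m_def c_def)
    finally have *: "(LINT x|leb ?i. f x * complex_of_real (p x)) = c * complex_of_real (LINT x|leb ?i. p x)"
      by simp
    have "(LINT x|leb ?i. (f x - c) * complex_of_real (p x)) =
        (LINT x|leb ?i. f x * complex_of_real (p x) - c * complex_of_real (p x))"
      by (simp add: left_diff_distrib)
    also have "\<dots> = 0"
      using i test_function_integrable[OF p] by (simp add: *)
    finally show "(LINT x|leb ?i. (f x - c) * complex_of_real (p x)) = 0" .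
  qed
  then have "u = abs_L2 (\<lambda>_. c)"
    unfolding u by (subst abs_L2_eq_iff) (auto intro: f square_integrable_continuous)
  then show thesis by (rule that)
qed



section \<open>Calculus in the first Sobolev space\<close>

lemma square_integrable_truncate:
  assumes "square_integrable i f"
  shows "square_integrable i (\<lambda>y. indicator {..x::real} y *\<^sub>R f y)"
proof -
  have "integrable (leb i) (\<lambda>y. indicator {..x} y *\<^sub>R (cmod (f y))\<^sup>2)"
    using assms unfolding square_integrable_def by (intro integrable_truncate) blast
  moreover have "(cmod (indicator {..x} y *\<^sub>R f y))\<^sup>2 = indicator {..x} y *\<^sub>R (cmod (f y))\<^sup>2" for y
    by (simp add: indicator_def)
  moreover have "(\<lambda>y. indicator {..x} y *\<^sub>R f y) \<in> borel_measurable (leb i)"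
    by (intro borel_measurable_integrable integrable_truncate square_integrable_integrable assms)
  ultimately show ?thesis unfolding square_integrable_def by (simp only:)
qed

text \<open>Truncation localises an identity on the whole interval to the part left of \<open>x\<close> without
leaving \<open>L\<^sup>2\<close>. As an orthogonal projection commuting with complex scalars it
turns pointwise estimates into inner product algebra.\<close>

lift_definition truncate :: "real \<Rightarrow> 'i::bounded_interval L2 \<Rightarrow> 'i L2" is
  "\<lambda>x f y. indicator {..x} y *\<^sub>R f y"
  by (auto simp: l2_rel_def intro: square_integrable_truncate elim!: AE_mp)

lemma truncate_abs: "square_integrable TYPE('i::bounded_interval) f \<Longrightarrow>
    truncate x (abs_L2 f :: 'i L2) = abs_L2 (\<lambda>y. indicator {..x} y *\<^sub>R f y)"
  by (simp add: truncate.abs_eq l2_rel_refl_iff)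

lemma inner_scaleC_L2:
  fixes u v :: "'i::bounded_interval L2"
  shows "(c *\<^sub>C u) \<bullet> v = u \<bullet> (cnj c *\<^sub>C v)"
  by transfer (simp add: inner_complex_def algebra_simps)

lemma truncate_scaleC: "truncate x (c *\<^sub>C u) = c *\<^sub>C truncate x (u :: 'i::bounded_interval L2)"
proof -
  obtain f where f: "square_integrable TYPE('i) f" "u = abs_L2 f" by (rule abs_L2_cases)
  then show ?thesis
    by (simp add: truncate_abs abs_L2_ops(3) square_integrable_truncate square_integrable_scale)
qed

lemma truncate_diff: "truncate x (u - v) = truncate x u - truncate x (v :: 'i::bounded_interval L2)"
proof -
  obtain f where f: "square_integrable TYPE('i) f" "u = abs_L2 f" by (rule abs_L2_cases)
  obtain g where g: "square_integrable TYPE('i) g" "v = abs_L2 g" by (rule abs_L2_cases)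
  from f g show ?thesis
    by (simp add: truncate_abs abs_L2_ops(2) square_integrable_truncate square_integrable_diff scaleR_diff_right)
qed

lemma inner_truncate: "truncate x u \<bullet> v = u \<bullet> truncate x (v :: 'i::bounded_interval L2)"
  by transfer simp

lemma truncate_truncate: "truncate x (truncate x u) = truncate x (u :: 'i::bounded_interval L2)"
proof -
  obtain f where f: "square_integrable TYPE('i) f" "u = abs_L2 f" by (rule abs_L2_cases)
  have "indicator {..x} y *\<^sub>R indicator {..x} y *\<^sub>R f y = indicator {..x} y *\<^sub>R f y" for y
    by (simp add: indicator_def)
  then show ?thesis
    unfolding f(2) truncate_abs[OF f(1)] truncate_abs[OF square_integrable_truncate[OF f(1)]] by (simp only:)
qed

lemma norm_truncate_le: "norm (truncate x u) \<le> norm (u :: 'i::bounded_interval L2)"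
proof -
  have "(norm (truncate x u))\<^sup>2 = truncate x u \<bullet> u"
    by (simp add: power2_norm_eq_inner inner_truncate truncate_truncate)
  also have "\<dots> \<le> norm (truncate x u) * norm u" by (rule norm_cauchy_schwarz)
  finally have "norm (truncate x u) * norm (truncate x u) \<le> norm (truncate x u) * norm u" by (simp add: power2_eq_square)
  then show ?thesis by (cases "norm (truncate x u) = 0") (simp_all add: mult_le_cancel_left)
qed

lemma inner_truncate_le: "\<bar>truncate x u \<bullet> v\<bar> \<le> norm u * norm (v :: 'i::bounded_interval L2)"
proof -
  have "\<bar>truncate x u \<bullet> v\<bar> \<le> norm (truncate x u) * norm v" by (rule Cauchy_Schwarz_ineq2)
  also have "\<dots> \<le> norm u * norm v" by (intro mult_right_mono norm_truncate_le) simp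
  finally show ?thesis .
qed

lemma continuous_eq_if_AE_eq:
  fixes f g :: "real \<Rightarrow> complex"
  assumes ab: "a < b" and f: "continuous_on {a..b} f" and g: "continuous_on {a..b} g"
    and eq: "AE x in lborel. x \<in> {a<..<b} \<longrightarrow> f x = g x" and c: "c \<in> {a..b}"
  shows "f c = g c"
proof -
  have int: "f x - g x = 0" if x: "x \<in> {a<..<b}" for x
  proof -
    let ?C = "{x \<in> {a..b}. f x - g x = 0}"
    have "closed (((\<lambda>x. f x - g x) -` {0}) \<inter> {a..b})"
      using continuous_on_closed_vimage[of "{a..b}" "\<lambda>x. f x - g x"] continuous_on_diff[OF f g]
      by (metis closed_atLeastAtMost closed_singleton)
    then have C: "closed ?C" by (auto simp: vimage_def Int_def conj_commute)
    have "AE x\<in>{a<..<b} in lebesgue. x \<in> ?C"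
      using AE_completion[OF eq] by (rule eventually_mono) auto
    from mem_closed_if_AE_lebesgue_open[OF open_greaterThanLessThan C this x]
    show ?thesis by simp
  qed
  have "f c - g c = 0"
  proof (rule continuous_constant_on_closure[where S = "{a<..<b}"])
    show "continuous_on (closure {a<..<b}) (\<lambda>x. f x - g x)"
      using ab by (auto intro!: continuous_intros f g)
  qed (use ab c int in auto)
  then show ?thesis by simp
qed

lemma point_value_abs:
  assumes f: "continuous_on UNIV f" and c: "c \<in> {left_end TYPE('i)..right_end TYPE('i)}"
  shows "point_value (abs_L2 f :: 'i::bounded_interval L2) c = f c"
  unfolding point_value_def
proof (rule the_equality)
  have s: "square_integrable TYPE('i) f" by (rule square_integrable_continuous[OF f])
  show "\<exists>g. continuous_on {left_end TYPE('i)..right_end TYPE('i)} g \<and>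
      (AE x in leb TYPE('i). rep_L2 (abs_L2 f :: 'i L2) x = g x) \<and> g c = f c"
    using rep_abs_L2[OF s] continuous_on_subset[OF f subset_UNIV] by blast
  fix y assume "\<exists>g. continuous_on {left_end TYPE('i)..right_end TYPE('i)} g \<and>
      (AE x in leb TYPE('i). rep_L2 (abs_L2 f :: 'i L2) x = g x) \<and> g c = y"
  then obtain g where g: "continuous_on {left_end TYPE('i)..right_end TYPE('i)} g" "g c = y"
    and eq: "AE x in leb TYPE('i). rep_L2 (abs_L2 f :: 'i L2) x = g x" by blast
  have "AE x in leb TYPE('i). g x = f x"
    using eq rep_abs_L2[OF s] by eventually_elim simp
  then have "g c = f c"
    unfolding AE_leb_iff
    by (intro continuous_eq_if_AE_eq[OF left_less_right g(1) continuous_on_subset[OF f subset_UNIV] _ c])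
  with g(2) show "y = f c" by simp
qed

lemma weak_deriv_primitive:
  assumes "square_integrable TYPE('i::bounded_interval) g"
  shows "weak_deriv (abs_L2 (\<lambda>x. c + primitive TYPE('i) g x) :: 'i L2) (abs_L2 g)"
  using weak_deriv_mult_primitive[OF assms, of "\<lambda>_. 1" "\<lambda>_. 0" c] by simp

text \<open>The primitive of \<open>wD u\<close> has the same weak derivative as \<open>u\<close>, so the two differ by a constant. The
primitive is continuous, hence this representative is the one that \<open>point_value\<close> evaluates.\<close>

lemma H1_representation:
  fixes u :: "'i::bounded_interval L2"
  assumes u: "u \<in> H1_space"
  defines "U \<equiv> \<lambda>x. point_value u (left_end TYPE('i)) + primitive TYPE('i) (rep_L2 (wD u)) x"
  shows "u = abs_L2 U" and "continuous_on UNIV U"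
    and "x \<in> {left_end TYPE('i)..right_end TYPE('i)} \<Longrightarrow> point_value u x = U x"
proof -
  let ?g = "rep_L2 (wD u)"
  note g = rep_L2(1)[of "wD u"]
  have Pc: "continuous_on UNIV (\<lambda>x. c + primitive TYPE('i) ?g x)" for c
    by (intro continuous_intros primitive_continuous square_integrable_integrable g)
  then show "continuous_on UNIV U" unfolding U_def .
  have "weak_deriv (u - abs_L2 (\<lambda>x. 0 + primitive TYPE('i) ?g x)) (wD u - abs_L2 ?g)"
    by (intro weak_deriv_diff weak_deriv_wD u weak_deriv_primitive g)
  then have "weak_deriv (u - abs_L2 (\<lambda>x. 0 + primitive TYPE('i) ?g x)) 0"
    by (simp add: rep_L2(2))
  then obtain c where "u - abs_L2 (\<lambda>x. 0 + primitive TYPE('i) ?g x) = abs_L2 (\<lambda>_. c)"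
    by (rule weak_deriv_zero_imp_const)
  then have "u = abs_L2 (\<lambda>_. c) + abs_L2 (\<lambda>x. 0 + primitive TYPE('i) ?g x)" by (simp add: algebra_simps)
  also have "\<dots> = abs_L2 (\<lambda>x. c + primitive TYPE('i) ?g x)"
    by (subst abs_L2_ops) (auto intro!: square_integrable_continuous Pc[of 0, simplified])
  finally have eq: "u = abs_L2 (\<lambda>x. c + primitive TYPE('i) ?g x)" .
  have pv: "point_value u x = c + primitive TYPE('i) ?g x" if "x \<in> {left_end TYPE('i)..right_end TYPE('i)}" for x
    by (subst eq) (rule point_value_abs[OF Pc that])
  have "point_value u (left_end TYPE('i)) = c"
    using pv[of "left_end TYPE('i)"] left_less_right[where 'a='i] by (simp add: primitive_left)
  then have U: "U = (\<lambda>x. c + primitive TYPE('i) ?g x)" by (simp add: U_def)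
  show "u = abs_L2 U" unfolding U by (rule eq)
  show "x \<in> {left_end TYPE('i)..right_end TYPE('i)} \<Longrightarrow> point_value u x = U x"
    unfolding U by (rule pv)
qed

lemma H1_continuous_representative:
  fixes u :: "'i::bounded_interval L2"
  assumes "u \<in> H1_space"
  obtains f where "continuous_on UNIV f" "u = abs_L2 f"
    "\<And>x. x \<in> {left_end TYPE('i)..right_end TYPE('i)} \<Longrightarrow> point_value u x = f x"
  using H1_representation[OF assms] that by blast

lemma H1_space_scaleC: "u \<in> H1_space \<Longrightarrow> c *\<^sub>C u \<in> H1_space"
  by (rule H1_space_closed(5))

lemma point_value_ops:
  fixes u v :: "'i::bounded_interval L2"
  assumes u: "u \<in> H1_space" and v: "v \<in> H1_space"
    and x: "x \<in> {left_end TYPE('i)..right_end TYPE('i)}"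
  shows "point_value (u + v) x = point_value u x + point_value v x"
    and "point_value (u - v) x = point_value u x - point_value v x"
proof -
  obtain f where f: "continuous_on UNIV f" "u = abs_L2 f"
    "\<And>x. x \<in> {left_end TYPE('i)..right_end TYPE('i)} \<Longrightarrow> point_value u x = f x"
    using H1_continuous_representative[OF u] by blast
  obtain g where g: "continuous_on UNIV g" "v = abs_L2 g"
    "\<And>x. x \<in> {left_end TYPE('i)..right_end TYPE('i)} \<Longrightarrow> point_value v x = g x"
    using H1_continuous_representative[OF v] by blast
  note s = square_integrable_continuous[OF f(1)] square_integrable_continuous[OF g(1)]
  show "point_value (u + v) x = point_value u x + point_value v x"
    "point_value (u - v) x = point_value u x - point_value v x"
    unfolding f(3)[OF x] g(3)[OF x] unfolding f(2) g(2) abs_L2_ops[OF s]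
    by (rule point_value_abs[OF _ x]; intro continuous_intros f g)+
qed

lemma point_value_scaleC:
  fixes u :: "'i::bounded_interval L2"
  assumes u: "u \<in> H1_space" and x: "x \<in> {left_end TYPE('i)..right_end TYPE('i)}"
  shows "point_value (c *\<^sub>C u) x = c * point_value u x"
proof -
  obtain f where f: "continuous_on UNIV f" "u = abs_L2 f"
    "\<And>x. x \<in> {left_end TYPE('i)..right_end TYPE('i)} \<Longrightarrow> point_value u x = f x"
    using H1_continuous_representative[OF u] by blast
  note s = square_integrable_continuous[OF f(1)]
  show ?thesis
    unfolding f(3)[OF x] unfolding f(2) abs_L2_ops(3)[OF s s]
    by (rule point_value_abs[OF _ x]) (intro continuous_intros f)
qed

text \<open>Both factors are a constant plus a primitive, and the claim is the real part of
\<open>primitive_mult\<close> for \<open>wD u\<close> and the conjugate of \<open>wD v\<close>.\<close>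

lemma integral_by_parts_truncate:
  fixes u v :: "'i::bounded_interval L2"
  assumes u: "u \<in> H1_space" and v: "v \<in> H1_space"
    and x: "x \<in> {left_end TYPE('i)..right_end TYPE('i)}"
  shows "truncate x (wD u) \<bullet> v + truncate x u \<bullet> wD v =
    point_value u x \<bullet> point_value v x - point_value u (left_end TYPE('i)) \<bullet> point_value v (left_end TYPE('i))"
proof -
  let ?i = "TYPE('i)"
  define a b where "a = point_value u (left_end ?i)" and "b = point_value v (left_end ?i)"
  define f g where "f = rep_L2 (wD u)" and "g = rep_L2 (wD v)"
  define U V where "U = (\<lambda>x. a + primitive ?i f x)" and "V = (\<lambda>x. b + primitive ?i g x)"
  have f: "square_integrable ?i f" "wD u = abs_L2 f" and g: "square_integrable ?i g" "wD v = abs_L2 g"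
    by (simp_all add: f_def g_def rep_L2)
  have U: "u = abs_L2 U" "continuous_on UNIV U" "point_value u x = U x"
    unfolding U_def a_def f_def using H1_representation[OF u] x by blast+
  have V: "v = abs_L2 V" "continuous_on UNIV V" "point_value v x = V x"
    unfolding V_def b_def g_def using H1_representation[OF v] x by blast+
  have fi: "integrable (leb ?i) f" and gi: "integrable (leb ?i) (\<lambda>x. cnj (g x))"
    using square_integrable_integrable[OF f(1)] square_integrable_integrable[OF g(1)] by simp_all
  have sU: "square_integrable ?i U" and sV: "square_integrable ?i V"
    using U(2) V(2) by (auto intro: square_integrable_continuous)
  let ?h1 = "\<lambda>y. f y * cnj (V y)" and ?h2 = "\<lambda>y. U y * cnj (g y)"
  have h1: "integrable (leb ?i) ?h1"
    by (intro integrable_bounded_mult fi continuous_intros V)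
  have h2: "integrable (leb ?i) ?h2"
    using integrable_bounded_mult[OF gi U(2)] by (simp add: mult.commute)
  have inner: "z \<bullet> w = Re (z * cnj w)" for z w :: complex by (simp add: inner_complex_def)
  have Re_primitive: "(LINT y|leb ?i. indicator {..x} y * (F y \<bullet> G y)) = Re (primitive ?i (\<lambda>y. F y * cnj (G y)) x)"
    if "integrable (leb ?i) (\<lambda>y. F y * cnj (G y))" for F G :: "real \<Rightarrow> complex"
    unfolding primitive_def inner
    by (subst integral_Re[symmetric]) (use integrable_truncate[OF that] in simp_all)
  have "truncate x (wD u) \<bullet> v + truncate x u \<bullet> wD v = Re (primitive ?i ?h1 x) + Re (primitive ?i ?h2 x)"
    unfolding f(2) g(2) unfolding U(1) V(1)
    by (simp add: truncate_abs abs_L2_ops f g sU sV square_integrable_truncate Re_primitive h1 h2)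
  also have "\<dots> = Re (primitive ?i (\<lambda>y. ?h1 y + ?h2 y) x)" by (simp add: primitive_add[OF h1 h2])
  also have "(\<lambda>y. ?h1 y + ?h2 y) = (\<lambda>y. (cnj b * f y + a * cnj (g y)) +
      (f y * primitive ?i (\<lambda>x. cnj (g x)) y + primitive ?i f y * cnj (g y)))"
    by (simp add: U_def V_def primitive_cnj algebra_simps)
  also have "primitive ?i \<dots> x = (cnj b * primitive ?i f x + a * primitive ?i (\<lambda>x. cnj (g x)) x) +
      primitive ?i f x * primitive ?i (\<lambda>x. cnj (g x)) x"
  proof -
    have "integrable (leb ?i) (\<lambda>y. f y * primitive ?i (\<lambda>x. cnj (g x)) y)"
      "integrable (leb ?i) (\<lambda>y. primitive ?i f y * cnj (g y))"
      using integrable_bounded_mult[OF fi primitive_continuous[OF gi]]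
        integrable_bounded_mult[OF gi primitive_continuous[OF fi]] by (simp_all add: mult.commute)
    then show ?thesis
      using fi gi by (simp add: primitive_add primitive_scale primitive_mult)
  qed
  also have "Re \<dots> = U x \<bullet> V x - a \<bullet> b"
    unfolding inner U_def V_def primitive_cnj by (simp add: algebra_simps)
  finally show ?thesis unfolding U(3) V(3) a_def b_def .
qed

lemma integral_const_leb: "(LINT x|leb TYPE('i::bounded_interval). m) = m * (right_end TYPE('i) - left_end TYPE('i))" for m :: real
  unfolding integral_leb using left_less_right[where 'a='i] by simp

lemma norm_abs_L2:
  assumes "square_integrable TYPE('i::bounded_interval) f"
  shows "(norm (abs_L2 f :: 'i L2))\<^sup>2 = (LINT x|leb TYPE('i). (cmod (f x))\<^sup>2)"
  using abs_L2_ops(4)[OF assms assms] by (simp add: power2_norm_eq_inner)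

lemma norm_ge_if_point_value_ge:
  fixes u :: "'i::bounded_interval L2"
  assumes u: "u \<in> H1_space"
    and m: "\<And>x. x \<in> {left_end TYPE('i)..right_end TYPE('i)} \<Longrightarrow> m \<le> (cmod (point_value u x))\<^sup>2"
  shows "m * (right_end TYPE('i) - left_end TYPE('i)) \<le> (norm u)\<^sup>2"
proof -
  obtain f where f: "continuous_on UNIV f" "u = abs_L2 f"
    "\<And>x. x \<in> {left_end TYPE('i)..right_end TYPE('i)} \<Longrightarrow> point_value u x = f x"
    using H1_continuous_representative[OF u] by blast
  have "(LINT x|leb TYPE('i). m) \<le> (LINT x|leb TYPE('i). (cmod (f x))\<^sup>2)"
  proof (rule integral_mono_AE)
    show "AE x in leb TYPE('i). m \<le> (cmod (f x))\<^sup>2"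
      using AE_leb_mem by eventually_elim (use m f(3) in force)
  qed (auto intro!: integrable_leb_continuous continuous_intros f)
  then show ?thesis
    unfolding integral_const_leb by (simp add: f(2) norm_abs_L2[OF square_integrable_continuous[OF f(1)]])
qed

lemma norm_le_if_point_value_le:
  fixes u v :: "'i::bounded_interval L2"
  assumes u: "u \<in> H1_space" and v: "v \<in> H1_space"
    and m: "\<And>x. x \<in> {left_end TYPE('i)..right_end TYPE('i)} \<Longrightarrow>
      (cmod (point_value u x))\<^sup>2 + (cmod (point_value v x))\<^sup>2 \<le> m"
  shows "(norm u)\<^sup>2 + (norm v)\<^sup>2 \<le> m * (right_end TYPE('i) - left_end TYPE('i))"
proof -
  obtain f where f: "continuous_on UNIV f" "u = abs_L2 f"
    "\<And>x. x \<in> {left_end TYPE('i)..right_end TYPE('i)} \<Longrightarrow> point_value u x = f x"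
    using H1_continuous_representative[OF u] by blast
  obtain g where g: "continuous_on UNIV g" "v = abs_L2 g"
    "\<And>x. x \<in> {left_end TYPE('i)..right_end TYPE('i)} \<Longrightarrow> point_value v x = g x"
    using H1_continuous_representative[OF v] by blast
  have i: "integrable (leb TYPE('i)) (\<lambda>x. (cmod (f x))\<^sup>2)" "integrable (leb TYPE('i)) (\<lambda>x. (cmod (g x))\<^sup>2)"
    by (intro integrable_leb_continuous continuous_intros f g)+
  have "(LINT x|leb TYPE('i). (cmod (f x))\<^sup>2 + (cmod (g x))\<^sup>2) \<le> (LINT x|leb TYPE('i). m)"
  proof (rule integral_mono_AE)
    show "AE x in leb TYPE('i). (cmod (f x))\<^sup>2 + (cmod (g x))\<^sup>2 \<le> m"
      using AE_leb_mem by eventually_elim (use m f(3) g(3) in force)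
  qed (auto intro!: integrable_leb_continuous continuous_intros f g)
  then show ?thesis
    unfolding integral_const_leb
    using i by (simp add: f(2) g(2) norm_abs_L2 square_integrable_continuous f(1) g(1))
qed

lemma truncate_right: "truncate (right_end TYPE('i)) u = (u :: 'i::bounded_interval L2)"
proof -
  obtain f where f: "square_integrable TYPE('i) f" "u = abs_L2 f" by (rule abs_L2_cases)
  show ?thesis
    unfolding f(2) truncate_abs[OF f(1)]
    by (subst abs_L2_eq_iff[OF square_integrable_truncate[OF f(1)] f(1)])
      (rule eventually_mono[OF AE_leb_mem], simp)
qed

lemma integral_by_parts:
  fixes u v :: "'i::bounded_interval L2"
  assumes "u \<in> H1_space" "v \<in> H1_space"
  shows "wD u \<bullet> v + u \<bullet> wD v =
    point_value u (right_end TYPE('i)) \<bullet> point_value v (right_end TYPE('i))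
    - point_value u (left_end TYPE('i)) \<bullet> point_value v (left_end TYPE('i))"
  using integral_by_parts_truncate[OF assms, of "right_end TYPE('i)"] left_less_right[where 'a='i]
  by (simp add: truncate_right)

text \<open>Integrating \<open>(|u|\<^sup>2)'\<close> from the left end point to \<open>x\<close> and to \<open>y\<close> costs
\<open>2 \<parallel>u\<parallel> \<parallel>u'\<parallel>\<close> each time.\<close>

lemma point_value_square_diff:
  fixes u :: "'i::bounded_interval L2"
  assumes u: "u \<in> H1_space" and x: "x \<in> {left_end TYPE('i)..right_end TYPE('i)}"
    and y: "y \<in> {left_end TYPE('i)..right_end TYPE('i)}"
  shows "(cmod (point_value u x))\<^sup>2 \<le> (cmod (point_value u y))\<^sup>2 + 4 * (norm u * norm (wD u))"
proof -
  have *: "\<bar>(cmod (point_value u z))\<^sup>2 - (cmod (point_value u (left_end TYPE('i))))\<^sup>2\<bar> \<le> 2 * (norm u * norm (wD u))"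
    if "z \<in> {left_end TYPE('i)..right_end TYPE('i)}" for z
    using integral_by_parts_truncate[OF u u that] inner_truncate_le[of z "wD u" u] inner_truncate_le[of z u "wD u"]
    by (simp add: power2_norm_eq_inner mult.commute abs_le_iff)
  show ?thesis using *[OF x] *[OF y] by linarith
qed

section \<open>Linear initial value problems\<close>

text \<open>Variation of constants: the solution is \<open>exp (l x) (C + \<integral> exp (- l y) k(y) dy)\<close>. The initial point
\<open>c\<close> may be anywhere in the closed interval, since \<open>C\<close> can be fitted to the value at \<open>c\<close>.\<close>

lemma first_order_ivp:
  fixes k :: "'i::bounded_interval L2"
  assumes c: "c \<in> {left_end TYPE('i)..right_end TYPE('i)}"
  obtains z where "z \<in> H1_space" "wD z = l *\<^sub>C z + k" "point_value z c = z0"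
proof -
  let ?i = "TYPE('i)"
  define e where "e l x = exp (l * complex_of_real x)" for l x
  have e: "(e l has_vector_derivative l * e l x) (at x)" for l x
    unfolding e_def by (auto intro!: has_vector_derivative_real_field derivative_eq_intros)
  have ec: "continuous_on S (e l)" for S l unfolding e_def by (intro continuous_intros)
  obtain f where f: "square_integrable ?i f" "k = abs_L2 f" by (rule abs_L2_cases)
  define g where "g x = e (- l) x * f x" for x
  have g: "square_integrable ?i g"
    unfolding g_def by (rule square_integrable_mult_continuous[OF f(1) ec])
  have Pc: "continuous_on UNIV (primitive ?i g)"
    by (rule primitive_continuous[OF square_integrable_integrable[OF g]])
  define C where "C = e (- l) c * z0 - primitive ?i g c"
  define F where "F x = e l x * (C + primitive ?i g x)" for x
  have F: "continuous_on UNIV F" unfolding F_def by (intro continuous_intros ec Pc)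
  note sF = square_integrable_continuous[OF F]
  have "weak_deriv (abs_L2 F :: 'i L2) (abs_L2 (\<lambda>x. l * e l x * (C + primitive ?i g x) + e l x * g x))"
    unfolding F_def by (rule weak_deriv_mult_primitive[OF g e]) (intro continuous_intros ec)
  also have "(\<lambda>x. l * e l x * (C + primitive ?i g x) + e l x * g x) = (\<lambda>x. l * F x + f x)"
    by (simp add: F_def g_def e_def fun_eq_iff exp_minus)
  also have "abs_L2 \<dots> = l *\<^sub>C abs_L2 F + k"
    unfolding f(2) abs_L2_ops(3)[OF sF sF] abs_L2_ops(1)[OF square_integrable_scale[OF sF] f(1)] ..
  finally have wd: "weak_deriv (abs_L2 F :: 'i L2) (l *\<^sub>C abs_L2 F + k)" .
  have "point_value (abs_L2 F :: 'i L2) c = z0"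
    by (subst point_value_abs[OF F c]) (simp add: F_def C_def e_def exp_minus)
  with wd show thesis
    by (intro that[of "abs_L2 F"]) (auto simp: H1_space_def wD_eq)
qed

text \<open>The operator factors as \<open>D\<^sup>2 - l\<^sup>2 = (D - l) (D + l)\<close>, so the problem is solved by two problems of first
order: one for \<open>z = u' + l u\<close>, then one for \<open>u\<close>.\<close>

lemma second_order_ivp:
  fixes k :: "'i::bounded_interval L2"
  assumes c: "c \<in> {left_end TYPE('i)..right_end TYPE('i)}"
  obtains u where "u \<in> H2_space" "wD (wD u) = l\<^sup>2 *\<^sub>C u + k"
    "point_value u c = a" "point_value (wD u) c = b"
proof -
  obtain z where z: "z \<in> H1_space" "wD z = l *\<^sub>C z + k" "point_value z c = b + l * a"
    using first_order_ivp[OF c] .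
  obtain u where u: "u \<in> H1_space" "wD u = (- l) *\<^sub>C u + z" "point_value u c = a"
    using first_order_ivp[OF c] .
  have lu: "(- l) *\<^sub>C u \<in> H1_space" by (rule H1_space_scaleC[OF u(1)])
  have "wD u \<in> H1_space" unfolding u(2) by (rule H1_space_closed[OF lu z(1)])
  then have "u \<in> H2_space" using u(1) by (simp add: H2_space_def)
  moreover have "wD (wD u) = (- l) *\<^sub>C wD u + wD z"
    by (subst u(2)) (simp add: wD_add lu z(1) wD_scaleC u(1))
  then have "wD (wD u) = l\<^sup>2 *\<^sub>C u + ((- l) *\<^sub>C z + l *\<^sub>C z) + k"
    unfolding u(2) z(2) by (simp add: scaleC_add_right scaleC_scaleC power2_eq_square)
  then have "wD (wD u) = l\<^sup>2 *\<^sub>C u + k"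
    unfolding scaleC_add_left[symmetric] using scaleC_of_real[of 0 z] by simp
  moreover have "point_value (wD u) c = b"
    unfolding u(2) point_value_ops(1)[OF lu z(1) c] point_value_scaleC[OF u(1) c] z(3) u(3) by simp
  ultimately show thesis using u(3) that by blast
qed


section \<open>The energy estimates\<close>

lemma inner_imaginary:
  fixes x y :: "'i::bounded_interval L2"
  shows "((\<i> * complex_of_real s) *\<^sub>C x) \<bullet> y = - (x \<bullet> ((\<i> * complex_of_real s) *\<^sub>C y))"
    and "((\<i> * complex_of_real s) *\<^sub>C x) \<bullet> x = 0"
proof -
  have neg: "(- c) *\<^sub>C y = - (c *\<^sub>C y)" for c and y :: "'i L2"
  proof -
    have "(- c) *\<^sub>C y + c *\<^sub>C y = 0"
      unfolding scaleC_add_left[symmetric] using scaleC_of_real[of 0 y] by simp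
    then show ?thesis by (simp add: eq_neg_iff_add_eq_0)
  qed
  show *: "((\<i> * complex_of_real s) *\<^sub>C x) \<bullet> y = - (x \<bullet> ((\<i> * complex_of_real s) *\<^sub>C y))" for y
    unfolding inner_scaleC_L2 by (simp add: neg)
  show "((\<i> * complex_of_real s) *\<^sub>C x) \<bullet> x = 0"
    using *[of x] by (simp add: inner_commute)
qed

lemma scaleC_imaginary: "(\<i> * complex_of_real s) *\<^sub>C x = s *\<^sub>R (\<i> *\<^sub>C (x :: 'i::bounded_interval L2))"
  by (simp add: scaleC_of_real[symmetric] scaleC_scaleC mult.commute)

lemma wave_ends: "left_end TYPE(wave_ivl) = -1" "right_end TYPE(wave_ivl) = 0"
  and heat_ends: "left_end TYPE(heat_ivl) = 0" "right_end TYPE(heat_ivl) = 1"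
  by (simp_all add: left_end_wave_ivl_def right_end_wave_ivl_def left_end_heat_ivl_def right_end_heat_ivl_def)

lemma H2_space_H1: "u \<in> H2_space \<Longrightarrow> u \<in> H1_space \<and> wD u \<in> H1_space"
  by (simp add: H2_space_def)

text \<open>With \<open>D = \<parallel>w'\<parallel>\<close>: the first two items are the real and the imaginary part of the equation tested
with \<open>w\<close>; as the inner product is the real part of the complex one, the second is obtained by testing
with \<open>i w\<close>. The next two hold
since \<open>w\<close> vanishes at \<open>1\<close>, so that \<open>|w|\<^sup>2\<close> is controlled by the integral of its derivative. The last one interpolates \<open>w'\<close> between \<open>D\<close> and \<open>\<parallel>w''\<parallel>\<close>, where \<open>w''\<close>
is read off from the equation.\<close>

lemma heat_estimates:
  fixes w h :: "heat_ivl L2"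
  assumes w: "w \<in> H2_space" and eq: "wD (wD w) = (\<i> * complex_of_real s) *\<^sub>C w - h"
    and w1: "point_value w 1 = 0"
  shows "(norm (wD w))\<^sup>2 = h \<bullet> w - point_value w 0 \<bullet> point_value (wD w) 0"
    and "\<bar>s\<bar> * (norm w)\<^sup>2 \<le> norm h * norm w + cmod (point_value (wD w) 0) * cmod (point_value w 0)"
    and "(cmod (point_value w 0))\<^sup>2 \<le> 2 * (norm w * norm (wD w))"
    and "norm w \<le> 4 * norm (wD w)"
    and "(cmod (point_value (wD w) 0))\<^sup>2 \<le>
      (norm (wD w))\<^sup>2 + 4 * (norm (wD w) * (\<bar>s\<bar> * norm w + norm h))"
proof -
  note ends = heat_ends
  have H1: "w \<in> H1_space" "wD w \<in> H1_space" using H2_space_H1[OF w] by blast+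
  have "wD w \<bullet> wD w + w \<bullet> wD (wD w) = - (point_value w 0 \<bullet> point_value (wD w) 0)"
    using integral_by_parts[OF H1] by (simp add: ends w1)
  moreover have "w \<bullet> wD (wD w) = - (h \<bullet> w)"
    unfolding eq inner_diff_right using inner_imaginary(2)[of s w] by (simp add: inner_commute)
  ultimately show "(norm (wD w))\<^sup>2 = h \<bullet> w - point_value w 0 \<bullet> point_value (wD w) 0"
    by (simp add: power2_norm_eq_inner)
  have iw: "\<i> *\<^sub>C w \<in> H1_space" "wD (\<i> *\<^sub>C w) = \<i> *\<^sub>C wD w"
    using H1_space_scaleC[OF H1(1)] wD_scaleC[OF H1(1)] by auto
  have "wD (wD w) \<bullet> (\<i> *\<^sub>C w) + wD w \<bullet> wD (\<i> *\<^sub>C w) =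
      - (point_value (wD w) 0 \<bullet> (\<i> * point_value w 0))"
    using integral_by_parts[OF H1(2) iw(1)] point_value_scaleC[OF H1(1)] by (simp add: ends w1)
  moreover have "wD w \<bullet> wD (\<i> *\<^sub>C w) = 0"
    using inner_imaginary(2)[of 1 "wD w"] by (simp add: iw(2) inner_commute)
  moreover have "wD (wD w) \<bullet> (\<i> *\<^sub>C w) = s * (norm w)\<^sup>2 - h \<bullet> (\<i> *\<^sub>C w)"
    unfolding eq inner_diff_left scaleC_imaginary by (simp add: power2_norm_eq_inner[symmetric] norm_scaleC)
  ultimately have "s * (norm w)\<^sup>2 = h \<bullet> (\<i> *\<^sub>C w) - point_value (wD w) 0 \<bullet> (\<i> * point_value w 0)"
    by linarith
  moreover have "\<bar>h \<bullet> (\<i> *\<^sub>C w)\<bar> \<le> norm h * norm w"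
    using Cauchy_Schwarz_ineq2[of h "\<i> *\<^sub>C w"] by (simp add: norm_scaleC)
  moreover have "\<bar>point_value (wD w) 0 \<bullet> (\<i> * point_value w 0)\<bar> \<le>
      cmod (point_value (wD w) 0) * cmod (point_value w 0)"
    using Cauchy_Schwarz_ineq2[of "point_value (wD w) 0" "\<i> * point_value w 0"] by (simp add: norm_mult)
  ultimately have "\<bar>s * (norm w)\<^sup>2\<bar> \<le> norm h * norm w + cmod (point_value (wD w) 0) * cmod (point_value w 0)"
    by linarith
  then show "\<bar>s\<bar> * (norm w)\<^sup>2 \<le> norm h * norm w + cmod (point_value (wD w) 0) * cmod (point_value w 0)"
    by (simp add: abs_mult)
  have "wD w \<bullet> w + w \<bullet> wD w = - (cmod (point_value w 0))\<^sup>2"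
    using integral_by_parts[OF H1(1) H1(1)] by (simp add: ends w1 power2_norm_eq_inner)
  moreover have "\<bar>w \<bullet> wD w\<bar> \<le> norm w * norm (wD w)" by (rule Cauchy_Schwarz_ineq2)
  ultimately show "(cmod (point_value w 0))\<^sup>2 \<le> 2 * (norm w * norm (wD w))"
    by (simp add: inner_commute)
  \<comment> \<open>The zero element fills the second slot of \<open>norm_le_if_point_value_le\<close>.\<close>
  have "(cmod (point_value w x))\<^sup>2 + (cmod (point_value (0 :: heat_ivl L2) x))\<^sup>2 \<le> 4 * (norm w * norm (wD w))"
    if "x \<in> {left_end TYPE(heat_ivl)..right_end TYPE(heat_ivl)}" for x
  proof -
    have "point_value (0 :: heat_ivl L2) x = 0"
      unfolding zero_L2_abs by (rule point_value_abs[OF _ that]) simp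
    then show ?thesis using point_value_square_diff[OF H1(1) that, of 1] by (simp add: ends w1)
  qed
  from norm_le_if_point_value_le[OF H1(1) zero_in_H1_space this]
  have "norm w * norm w \<le> norm w * (4 * norm (wD w))" by (simp add: ends power2_eq_square)
  then show "norm w \<le> 4 * norm (wD w)" by (cases "norm w = 0") (simp_all add: mult_le_cancel_left)
  have "(cmod (point_value (wD w) 0))\<^sup>2 - 4 * (norm (wD w) * norm (wD (wD w))) \<le> (cmod (point_value (wD w) x))\<^sup>2"
    if "x \<in> {left_end TYPE(heat_ivl)..right_end TYPE(heat_ivl)}" for x
    using point_value_square_diff[OF H1(2) _ that, of 0] by (simp add: ends)
  from norm_ge_if_point_value_ge[OF H1(2) this]
  have "(cmod (point_value (wD w) 0))\<^sup>2 \<le> (norm (wD w))\<^sup>2 + 4 * (norm (wD w) * norm (wD (wD w)))"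
    by (simp add: ends)
  moreover have "norm (wD (wD w)) \<le> \<bar>s\<bar> * norm w + norm h"
    unfolding eq using norm_triangle_ineq4[of "(\<i> * complex_of_real s) *\<^sub>C w" h]
    by (simp add: norm_scaleC norm_mult)
  then have "norm (wD w) * norm (wD (wD w)) \<le> norm (wD w) * (\<bar>s\<bar> * norm w + norm h)"
    by (rule mult_left_mono) simp
  ultimately show "(cmod (point_value (wD w) 0))\<^sup>2 \<le>
      (norm (wD w))\<^sup>2 + 4 * (norm (wD w) * (\<bar>s\<bar> * norm w + norm h))" by linarith
qed

text \<open>Here \<open>p\<close> stands for \<open>u'\<close> and \<open>k\<close> for \<open>f'\<close>, so that the wave equation becomes a first order system. Its
coefficient is imaginary, which makes the contributions of \<open>p\<close> and \<open>v\<close> to the derivative of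
the energy density \<open>|p|\<^sup>2 + |v|\<^sup>2\<close> cancel; only the data \<open>k\<close> and \<open>g\<close> move it. The first item is the
power that the wave part exchanges through the point \<open>0\<close>.\<close>

lemma wave_estimates:
  fixes p v k g :: "wave_ivl L2"
  assumes p: "p \<in> H1_space" and v: "v \<in> H1_space"
    and v': "wD v = (\<i> * complex_of_real s) *\<^sub>C p - k"
    and p': "wD p = (\<i> * complex_of_real s) *\<^sub>C v - g"
    and p1: "point_value p (-1) = 0"
  shows "point_value v 0 \<bullet> point_value p 0 = - (k \<bullet> p) - g \<bullet> v"
    and "(norm p)\<^sup>2 + (norm v)\<^sup>2 \<le> (cmod (point_value p 0))\<^sup>2 + (cmod (point_value v 0))\<^sup>2
      + 4 * (norm k * norm v + norm g * norm p)"
proof -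
  note ends = wave_ends
  let ?c = "\<i> * complex_of_real s"
  have "wD v \<bullet> p + v \<bullet> wD p = point_value v 0 \<bullet> point_value p 0"
    using integral_by_parts[OF v p] by (simp add: ends p1)
  moreover have "wD v \<bullet> p = - (k \<bullet> p)"
    unfolding v' inner_diff_left inner_imaginary(2) by simp
  moreover have "v \<bullet> wD p = - (g \<bullet> v)"
    unfolding p' inner_diff_right using inner_imaginary(2)[of s v] by (simp add: inner_commute)
  ultimately show "point_value v 0 \<bullet> point_value p 0 = - (k \<bullet> p) - g \<bullet> v" by linarith
  define E where "E x = (cmod (point_value p x))\<^sup>2 + (cmod (point_value v x))\<^sup>2" for x
  define S where "S = norm k * norm v + norm g * norm p"
  have E: "\<bar>E x - E (-1)\<bar> \<le> 2 * S" if x: "x \<in> {left_end TYPE(wave_ivl)..right_end TYPE(wave_ivl)}" for x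
  proof -
    have "truncate x (wD p) \<bullet> p + truncate x p \<bullet> wD p = 2 * (truncate x (wD p) \<bullet> p)" for p :: "wave_ivl L2"
      using inner_truncate[of x p "wD p"] inner_commute[of p "truncate x (wD p)"] by simp
    then have "E x - E (-1) = 2 * (truncate x (wD p) \<bullet> p + truncate x (wD v) \<bullet> v)"
      using integral_by_parts_truncate[OF p p x] integral_by_parts_truncate[OF v v x]
      by (simp add: E_def ends power2_norm_eq_inner)
    also have "truncate x (wD p) \<bullet> p + truncate x (wD v) \<bullet> v = - (truncate x g \<bullet> p) - truncate x k \<bullet> v"
    proof -
      have "(?c *\<^sub>C truncate x v) \<bullet> p + (?c *\<^sub>C truncate x p) \<bullet> v = 0"
        unfolding inner_imaginary(1)[of s "truncate x v"] inner_truncate truncate_scaleC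
        by (simp add: inner_commute[of v])
      then show ?thesis
        unfolding p' v' truncate_diff truncate_scaleC inner_diff_left by linarith
    qed
    finally have "E x - E (-1) = 2 * (- (truncate x g \<bullet> p) - truncate x k \<bullet> v)" .
    then show ?thesis
      using inner_truncate_le[of x g p] inner_truncate_le[of x k v]
      unfolding S_def abs_le_iff by argo
  qed
  have "E x \<le> E 0 + 4 * S" if "x \<in> {left_end TYPE(wave_ivl)..right_end TYPE(wave_ivl)}" for x
    using E[OF that] E[of 0] by (simp add: ends)
  from norm_le_if_point_value_le[OF p v this[unfolded E_def[of x for x]]]
  show "(norm p)\<^sup>2 + (norm v)\<^sup>2 \<le> (cmod (point_value p 0))\<^sup>2 + (cmod (point_value v 0))\<^sup>2
      + 4 * (norm k * norm v + norm g * norm p)"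
    by (simp add: ends E_def S_def)
qed

text \<open>With \<open>r = |s|\<^bsup>1/2\<^esup>\<close>, \<open>B = |w'(0)|\<close>, \<open>K = |w(0)|\<close>, \<open>W = \<parallel>w\<parallel>\<close>, \<open>D = \<parallel>w'\<parallel>\<close> and \<open>H = \<parallel>h\<parallel>\<close>, this is the step that determines the
growth rate. Either \<open>r\<^sup>2 W \<le> 2 H\<close>, and \<open>B\<close> is bounded by \<open>D\<close> and \<open>H\<close> at once; or
the boundary term dominates the bound for \<open>r\<^sup>2 W\<^sup>2\<close>, which gives \<open>r\<^sup>4 W\<^sup>3 \<le> 8 B\<^sup>2 D\<close>. In the latter case
\<open>B\<^sup>2\<close> is at most \<open>2 D\<^sup>2\<close> or at most \<open>12 D r\<^sup>2 W\<close>, and inserting the second bound cancels one factor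
\<open>r\<^sup>2 W\<close> and yields \<open>r W \<le> 10 D\<close>.\<close>

lemma boundary_flux_bound:
  fixes B D H K W r :: real
  assumes nonneg: "0 \<le> B" "0 \<le> D" "0 \<le> H" "0 \<le> K" "0 \<le> W" and r: "1 \<le> r"
    and W: "r\<^sup>2 * W\<^sup>2 \<le> H * W + B * K" and K: "K\<^sup>2 \<le> 2 * (W * D)"
    and B: "B\<^sup>2 \<le> D\<^sup>2 + 4 * (D * (r\<^sup>2 * W + H))"
  shows "B\<^sup>2 \<le> 126 * r * D\<^sup>2 + 6 * H\<^sup>2"
proof -
  have DH: "2 * (D * H) \<le> D\<^sup>2 + H\<^sup>2" using sum_squares_bound[of D H] by simp
  have rD: "D\<^sup>2 \<le> r * D\<^sup>2" using r by (simp add: mult_le_cancel_right1)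
  show ?thesis
  proof (cases "r\<^sup>2 * W \<le> 2 * H")
    case True
    then have "D * (r\<^sup>2 * W + H) \<le> D * (3 * H)" by (intro mult_left_mono) (use nonneg in auto)
    with B DH rD have "B\<^sup>2 \<le> D\<^sup>2 + 6 * (D\<^sup>2 + H\<^sup>2)" by simp
    with rD show ?thesis using zero_le_power2[of D] unfolding mult.assoc by argo
  next
    case False
    then have H2: "2 * H < r\<^sup>2 * W" by simp
    then have Wpos: "0 < W" using nonneg by (cases "W = 0") auto
    have "H * W \<le> r\<^sup>2 * W / 2 * W" by (rule mult_right_mono) (use H2 Wpos in linarith)+
    then have "r\<^sup>2 * W\<^sup>2 \<le> 2 * (B * K)" using W by (simp add: power2_eq_square)
    then have "(r\<^sup>2 * W\<^sup>2)\<^sup>2 \<le> (2 * (B * K))\<^sup>2" by (intro power_mono) auto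
    also have "\<dots> = 4 * B\<^sup>2 * K\<^sup>2" by (simp add: power_mult_distrib)
    also have "\<dots> \<le> 4 * B\<^sup>2 * (2 * (W * D))" by (intro mult_left_mono K) simp
    finally have "W * (r\<^sup>2 * (r\<^sup>2 * (W\<^sup>2 * W))) \<le> W * (8 * B\<^sup>2 * D)" by (simp add: power2_eq_square algebra_simps)
    then have W3: "r\<^sup>2 * (r\<^sup>2 * (W\<^sup>2 * W)) \<le> 8 * B\<^sup>2 * D" using Wpos by simp
    have B1: "B\<^sup>2 \<le> D\<^sup>2 + 6 * (D * (r\<^sup>2 * W))"
    proof -
      have "D * (r\<^sup>2 * W + H) \<le> D * (3 / 2 * (r\<^sup>2 * W))" by (rule mult_left_mono) (use nonneg H2 in linarith)+
      with B show ?thesis by simp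
    qed
    show ?thesis
    proof (cases "B\<^sup>2 \<le> 2 * D\<^sup>2")
      case True
      then show ?thesis using rD nonneg zero_le_power2[of H] zero_le_power2[of D] by linarith
    next
      case False
      with B1 have B2: "B\<^sup>2 \<le> 12 * (D * (r\<^sup>2 * W))" by linarith
      have "r\<^sup>2 * (r\<^sup>2 * (W\<^sup>2 * W)) \<le> 8 * (12 * (D * (r\<^sup>2 * W))) * D"
        using W3 by (rule order_trans) (intro mult_right_mono mult_left_mono B2, use nonneg in auto)
      then have "(r\<^sup>2 * W) * (r\<^sup>2 * W\<^sup>2) \<le> (r\<^sup>2 * W) * (96 * D\<^sup>2)" by (simp add: power2_eq_square algebra_simps)
      moreover have "0 < r\<^sup>2 * W" using Wpos r by simp
      ultimately have "r\<^sup>2 * W\<^sup>2 \<le> 96 * D\<^sup>2" by (simp only: mult_le_cancel_left_pos)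
      then have "(r * W)\<^sup>2 \<le> (10 * D)\<^sup>2" 
        by (simp add: power_mult_distrib) (use zero_le_power2[of D] in linarith)
      then have "r * W \<le> 10 * D" by (rule power2_le_imp_le) (use nonneg in simp)
      then have "(r * D) * (r * W) \<le> (r * D) * (10 * D)" by (rule mult_left_mono) (use nonneg r in simp)
      with B2 have "B\<^sup>2 \<le> 120 * (r * D\<^sup>2)" by (simp add: power2_eq_square algebra_simps)
      moreover have "0 \<le> r * D\<^sup>2" using r by simp
      ultimately show ?thesis using zero_le_power2[of H] by linarith
    qed
  qed
qed

lemma cauchy_schwarz3:
  fixes a b c x y z :: real
  assumes "a\<^sup>2 + b\<^sup>2 + c\<^sup>2 = Y\<^sup>2" "x\<^sup>2 + y\<^sup>2 + z\<^sup>2 = X\<^sup>2" "0 \<le> X" "0 \<le> Y"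
  shows "a * x + b * y + c * z \<le> Y * X"
proof -
  have "(a * x + b * y + c * z)\<^sup>2 \<le> (a\<^sup>2 + b\<^sup>2 + c\<^sup>2) * (x\<^sup>2 + y\<^sup>2 + z\<^sup>2)"
    using zero_le_power2[of "a * y - b * x"] zero_le_power2[of "a * z - c * x"] zero_le_power2[of "b * z - c * y"]
    by (simp add: power2_eq_square algebra_simps)
  then have "(a * x + b * y + c * z)\<^sup>2 \<le> (Y * X)\<^sup>2" using assms by (simp add: power_mult_distrib)
  then show ?thesis by (rule power2_le_imp_le) (use assms in simp)
qed

text \<open>The numbers are those of \<open>boundary_flux_bound\<close>, together with \<open>P = \<parallel>u'\<parallel>\<close>, \<open>V = \<parallel>v\<parallel>\<close>, \<open>F = \<parallel>f'\<parallel>\<close> and \<open>G = \<parallel>g\<parallel>\<close>. By the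
dissipation estimate for \<open>D\<^sup>2\<close>, all bounds combine to \<open>X\<^sup>2 \<le> 154 r Y X + 6 Y\<^sup>2\<close> for the energy norms
\<open>X\<close> and \<open>Y\<close> of solution and data, which is impossible if \<open>X > 160 r Y\<close>.\<close>

lemma energy_bound:
  fixes B D F G H K P V W r :: real
  assumes nonneg: "0 \<le> B" "0 \<le> D" "0 \<le> F" "0 \<le> G" "0 \<le> H" "0 \<le> K" "0 \<le> P" "0 \<le> V" "0 \<le> W"
    and r: "1 \<le> r"
    and W: "r\<^sup>2 * W\<^sup>2 \<le> H * W + B * K" and K: "K\<^sup>2 \<le> 2 * (W * D)" and WD: "W \<le> 4 * D"
    and B: "B\<^sup>2 \<le> D\<^sup>2 + 4 * (D * (r\<^sup>2 * W + H))"
    and D: "D\<^sup>2 \<le> F * P + G * V + H * W"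
    and PV: "P\<^sup>2 + V\<^sup>2 \<le> B\<^sup>2 + K\<^sup>2 + 4 * (F * V + G * P)"
  shows "P\<^sup>2 + V\<^sup>2 + W\<^sup>2 \<le> (160 * r)\<^sup>2 * (F\<^sup>2 + G\<^sup>2 + H\<^sup>2)"
proof -
  define X where "X = sqrt (P\<^sup>2 + V\<^sup>2 + W\<^sup>2)"
  define Y where "Y = sqrt (F\<^sup>2 + G\<^sup>2 + H\<^sup>2)"
  have X: "P\<^sup>2 + V\<^sup>2 + W\<^sup>2 = X\<^sup>2" "0 \<le> X" and Y: "F\<^sup>2 + G\<^sup>2 + H\<^sup>2 = Y\<^sup>2" "0 \<le> Y"
    by (simp_all add: X_def Y_def)
  have DXY: "D\<^sup>2 \<le> Y * X" using D cauchy_schwarz3[OF Y(1) X(1) X(2) Y(2)] by linarith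
  have "V\<^sup>2 + P\<^sup>2 + W\<^sup>2 = X\<^sup>2" using X(1) by simp
  from cauchy_schwarz3[OF Y(1) this X(2) Y(2)] have FV: "F * V + G * P \<le> Y * X"
    using mult_nonneg_nonneg[of H W] nonneg by linarith
  have "H\<^sup>2 \<le> Y\<^sup>2" using Y(1) zero_le_power2[of F] zero_le_power2[of G] by linarith
  moreover have "B\<^sup>2 \<le> 126 * r * D\<^sup>2 + 6 * H\<^sup>2"
    by (rule boundary_flux_bound[OF nonneg(1,2,5,6,9) r W K B])
  moreover have "K\<^sup>2 \<le> 8 * D\<^sup>2"
    using K mult_right_mono[OF WD nonneg(2)] by (simp add: power2_eq_square)
  moreover have "W\<^sup>2 \<le> 16 * D\<^sup>2"
    using power_mono[OF WD nonneg(9), of 2] by (simp add: power_mult_distrib)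
  ultimately have "X\<^sup>2 \<le> 126 * r * D\<^sup>2 + 24 * D\<^sup>2 + 6 * Y\<^sup>2 + 4 * (Y * X)"
    using PV FV X(1) unfolding mult.assoc by argo
  moreover have "126 * r * D\<^sup>2 \<le> 126 * r * (Y * X)" "24 * D\<^sup>2 \<le> 24 * (r * (Y * X))" "Y * X \<le> r * (Y * X)"
  proof -
    show "Y * X \<le> r * (Y * X)" using r X(2) Y(2) mult_right_mono[of 1 r "Y * X"] by simp
    with DXY show "24 * D\<^sup>2 \<le> 24 * (r * (Y * X))" by linarith
    show "126 * r * D\<^sup>2 \<le> 126 * r * (Y * X)" using r DXY by (intro mult_left_mono) auto
  qed
  ultimately have q: "X\<^sup>2 \<le> 154 * (r * (Y * X)) + 6 * Y\<^sup>2" by simp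
  have "X \<le> 160 * r * Y"
  proof (rule ccontr)
    assume "\<not> ?thesis"
    then have less: "160 * r * Y < X" by simp
    have "Y \<le> r * Y" using r Y by (simp add: mult_le_cancel_right1)
    moreover have "0 \<le> r * Y" using r Y by simp
    ultimately have YX: "Y \<le> X" and Xpos: "0 < X" using less by linarith+
    have "(160 * r * Y) * X < X * X" using less Xpos by simp
    moreover have "6 * Y\<^sup>2 \<le> 6 * (r * (Y * X))"
    proof -
      have "Y * Y \<le> Y * X" using YX Y by (intro mult_left_mono)
      also have "\<dots> \<le> r * (Y * X)" using r X(2) Y(2) mult_right_mono[of 1 r "Y * X"] by simp
      finally show ?thesis by (simp add: power2_eq_square)
    qed
    ultimately show False using q by (simp add: power2_eq_square algebra_simps)
  qed
  then have "X\<^sup>2 \<le> (160 * r * Y)\<^sup>2" using X by (intro power_mono)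
  then show ?thesis by (simp add: X(1) Y(1) power_mult_distrib)
qed

text \<open>The weak form of \<open>v = isu - f\<close> makes \<open>(u', v)\<close> a solution of the first order system of
\<open>wave_estimates\<close>. Its boundary energy at \<open>0\<close>, and the power exchanged there, are those of the
heat part by the coupling conditions. The energy seminorm misses the \<open>L\<^sup>2\<close> norm of \<open>u\<close>; it is recovered
from \<open>isu = v + f\<close>, where \<open>|s| \<ge> 1\<close> is used.\<close>

lemma a_priori_estimate:
  fixes u v f g :: "wave_ivl L2" and w h :: "heat_ivl L2"
  defines "c \<equiv> \<lambda>s. \<i> * complex_of_real s"
  assumes s: "1 \<le> \<bar>s\<bar>"
    and u: "u \<in> H2_space" and v: "v \<in> H1_space" and w: "w \<in> H2_space" and f: "f \<in> H1_space"
    and eqs: "c s *\<^sub>C u - v = f" "c s *\<^sub>C v - wD (wD u) = g" "c s *\<^sub>C w - wD (wD w) = h"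
    and bc: "point_value (wD u) (-1) = 0" "point_value w 1 = 0" "point_value v 0 = point_value w 0"
      "point_value (wD u) 0 = point_value (wD w) 0"
  shows "(norm u)\<^sup>2 + (norm (wD u))\<^sup>2 + (norm v)\<^sup>2 + (norm w)\<^sup>2 \<le>
    300\<^sup>2 * \<bar>s\<bar> * ((norm f)\<^sup>2 + (norm (wD f))\<^sup>2 + (norm g)\<^sup>2 + (norm h)\<^sup>2)"
proof -
  have uH: "u \<in> H1_space" "wD u \<in> H1_space" using H2_space_H1[OF u] by blast+
  have cu: "c s *\<^sub>C u \<in> H1_space" by (rule H1_space_scaleC[OF uH(1)])
  have "v = c s *\<^sub>C u - f" using eqs(1) by (simp add: algebra_simps)
  then have "weak_deriv v (c s *\<^sub>C wD u - wD f)"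
    using weak_deriv_diff[OF weak_deriv_scaleC[OF weak_deriv_wD[OF uH(1)]] weak_deriv_wD[OF f]] by simp
  then have v': "wD v = (\<i> * complex_of_real s) *\<^sub>C wD u - wD f" by (simp add: wD_eq c_def)
  have p': "wD (wD u) = (\<i> * complex_of_real s) *\<^sub>C v - g" using eqs(2) by (simp add: c_def algebra_simps)
  have q': "wD (wD w) = (\<i> * complex_of_real s) *\<^sub>C w - h" using eqs(3) by (simp add: c_def algebra_simps)
  note we = wave_estimates[OF uH(2) v v' p' bc(1)]
  note he = heat_estimates[OF w q' bc(2)]
  define r where "r = sqrt \<bar>s\<bar>"
  have r: "1 \<le> r" "r\<^sup>2 = \<bar>s\<bar>" using s by (simp_all add: r_def)
  have main: "(norm (wD u))\<^sup>2 + (norm v)\<^sup>2 + (norm w)\<^sup>2 \<le>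
      (160 * r)\<^sup>2 * ((norm (wD f))\<^sup>2 + (norm g)\<^sup>2 + (norm h)\<^sup>2)"
  proof (rule energy_bound[where B = "cmod (point_value (wD w) 0)" and K = "cmod (point_value w 0)" and D = "norm (wD w)"])
    show "(norm (wD w))\<^sup>2 \<le> norm (wD f) * norm (wD u) + norm g * norm v + norm h * norm w"
    proof -
      have "(norm (wD w))\<^sup>2 = h \<bullet> w + wD f \<bullet> wD u + g \<bullet> v"
        using he(1) we(1) bc(3,4) by simp
      then show ?thesis
        using norm_cauchy_schwarz[of h w] norm_cauchy_schwarz[of "wD f" "wD u"] norm_cauchy_schwarz[of g v]
        by linarith
    qed
  qed (use r he we bc in simp_all)
  have ul: "(norm u)\<^sup>2 \<le> 2 * (norm v)\<^sup>2 + 2 * (norm f)\<^sup>2"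
  proof -
    have "c s *\<^sub>C u = v + f" using eqs(1) by (simp add: algebra_simps)
    then have "\<bar>s\<bar> * norm u = norm (v + f)" by (metis c_def norm_scaleC norm_mult norm_ii norm_of_real mult_1)
    moreover have "norm u \<le> \<bar>s\<bar> * norm u" using s by (simp add: mult_le_cancel_right1)
    ultimately have "norm u \<le> norm v + norm f" using norm_triangle_ineq[of v f] by linarith
    then have "(norm u)\<^sup>2 \<le> (norm v + norm f)\<^sup>2" by (rule power_mono) simp
    then show ?thesis using sum_squares_bound[of "norm v" "norm f"] by (simp add: power2_sum)
  qed
  define Y where "Y = (norm (wD f))\<^sup>2 + (norm g)\<^sup>2 + (norm h)\<^sup>2"
  have m: "(norm (wD u))\<^sup>2 + (norm v)\<^sup>2 + (norm w)\<^sup>2 \<le> 25600 * (\<bar>s\<bar> * Y)"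
    using main r(2) by (simp add: power_mult_distrib Y_def)
  have "0 \<le> \<bar>s\<bar> * Y" by (simp add: Y_def)
  moreover have "(norm f)\<^sup>2 \<le> \<bar>s\<bar> * (norm f)\<^sup>2" using s by (simp add: mult_le_cancel_right1)
  ultimately have "(norm u)\<^sup>2 + (norm (wD u))\<^sup>2 + (norm v)\<^sup>2 + (norm w)\<^sup>2 \<le>
      90000 * (\<bar>s\<bar> * (norm f)\<^sup>2 + \<bar>s\<bar> * Y)"
    using ul m zero_le_power2[of "norm (wD u)"] zero_le_power2[of "norm w"] zero_le_power2[of "norm v"]
      zero_le_power2[of "norm f"] unfolding distrib_left by linarith
  then show ?thesis by (simp add: Y_def algebra_simps)
qed


section \<open>Resolvents of operators bounded from below\<close>

lemma scaleC_diff_right: "c *\<^sub>C (x - y) = c *\<^sub>C x - c *\<^sub>C (y :: 'a::complex_normed_space)"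
proof -
  have "c *\<^sub>C (x - y) + c *\<^sub>C y = c *\<^sub>C x" by (simp add: scaleC_add_right[symmetric])
  then show ?thesis by (simp add: algebra_simps)
qed

text \<open>A surjective operator \<open>l - A\<close> with a lower bound is bijective, and the lower bound is the norm bound of
its inverse.\<close>

lemma resolvent_set_and_norm:
  fixes D :: "'a::complex_normed_space set"
  assumes M: "0 \<le> M" and add: "\<And>x y. x \<in> D \<Longrightarrow> y \<in> D \<Longrightarrow> x + y \<in> D \<and> A (x + y) = A x + A y"
    and scale: "\<And>c x. x \<in> D \<Longrightarrow> c *\<^sub>C x \<in> D \<and> A (c *\<^sub>C x) = c *\<^sub>C A x"
    and surj: "\<And>y. \<exists>x\<in>D. l *\<^sub>C x - A x = y"
    and bound: "\<And>x. x \<in> D \<Longrightarrow> norm x \<le> M * norm (l *\<^sub>C x - A x)"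
  shows "l \<in> resolvent_set D A" and "onorm (resolvent D A l) \<le> M"
proof -
  let ?L = "\<lambda>x. l *\<^sub>C x - A x"
  let ?R = "resolvent D A l"
  have scaleR: "r *\<^sub>R x \<in> D \<and> A (r *\<^sub>R x) = r *\<^sub>R A x" if "x \<in> D" for r x
    using scale[OF that, of "complex_of_real r"] by (simp add: scaleC_of_real)
  have comm: "l *\<^sub>C r *\<^sub>R x = r *\<^sub>R l *\<^sub>C x" for r and x :: 'a
    by (simp add: scaleC_of_real[symmetric] scaleC_scaleC mult.commute)
  have inj: "x = x'" if x: "x \<in> D" "x' \<in> D" "?L x = ?L x'" for x x'
  proof -
    have m: "(-1) *\<^sub>R x' \<in> D" "A ((-1) *\<^sub>R x') = (-1) *\<^sub>R A x'" using scaleR[OF x(2), of "-1"] by auto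
    have "?L (x + (-1) *\<^sub>R x') = ?L x + (-1) *\<^sub>R ?L x'"
      using add[OF x(1) m(1)] m(2)
      by (simp only: scaleC_add_right comm scaleR_diff_right) (simp add: algebra_simps)
    also have "\<dots> = 0" using x(3) by simp
    finally show ?thesis using bound[of "x + (-1) *\<^sub>R x'"] add[OF x(1) m(1)] by simp
  qed
  have bij: "bij_betw ?L D UNIV"
    using inj surj by (auto simp: bij_betw_def inj_on_def image_iff set_eq_iff) metis
  have R: "?R y \<in> D" "?L (?R y) = y" for y
    using bij_betwE[OF bij_betw_inv_into[OF bij]] bij_betw_inv_into_right[OF bij, of y]
    by (auto simp: resolvent_def)
  have R_eq: "?R y = x" if "x \<in> D" "?L x = y" for x y
    using inj[OF R(1) that(1)] R(2) that(2) by simp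
  have Rn: "norm (?R y) \<le> M * norm y" for y using bound[OF R(1), of y] R(2)[of y] by simp
  have "bounded_linear ?R"
  proof (rule bounded_linear_intro)
    show "?R (x + y) = ?R x + ?R y" for x y
    proof (rule R_eq)
      have "?L (?R x + ?R y) = ?L (?R x) + ?L (?R y)"
        using add[OF R(1) R(1), of x y] by (simp add: scaleC_add_right)
      then show "?L (?R x + ?R y) = x + y" by (simp only: R(2))
    qed (use add R in blast)
    show "?R (r *\<^sub>R x) = r *\<^sub>R ?R x" for r x
    proof (rule R_eq)
      have "?L (r *\<^sub>R ?R x) = r *\<^sub>R ?L (?R x)"
        using scaleR[OF R(1), of r x] by (simp add: comm scaleR_diff_right)
      then show "?L (r *\<^sub>R ?R x) = r *\<^sub>R x" by (simp only: R(2))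
    qed (use scaleR R in blast)
    show "norm (?R x) \<le> norm x * M" for x using Rn[of x] by (simp add: mult.commute)
  qed
  with bij show "l \<in> resolvent_set D A" by (simp add: resolvent_set_def)
  show "onorm ?R \<le> M"
    by (rule onorm_bound[OF M Rn])
qed

section \<open>The resolvent of the coupled operator\<close>

lemma H2_space_add: "u \<in> H2_space \<Longrightarrow> v \<in> H2_space \<Longrightarrow> u + v \<in> H2_space"
  by (simp add: H2_space_def wD_add H1_space_closed)

lemma H2_space_scaleC: "u \<in> H2_space \<Longrightarrow> c *\<^sub>C u \<in> H2_space"
  by (simp add: H2_space_def wD_scaleC H1_space_scaleC)

lemma dom_A_iff:
  "(u, v, w) \<in> dom_A \<longleftrightarrow> H1_to_L2 u \<in> H2_space \<and> v \<in> H1_space \<and> w \<in> H2_space \<and>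
    point_value (wD (H1_to_L2 u)) (-1) = 0 \<and> point_value w 1 = 0 \<and>
    point_value v 0 = point_value w 0 \<and>
    point_value (wD (H1_to_L2 u)) 0 = point_value (wD w) 0"
  by (auto simp: dom_A_def Y_space_def)

lemma dom_A_add_scale:
  assumes "x \<in> dom_A" "y \<in> dom_A"
  shows "x + y \<in> dom_A" and "c *\<^sub>C x \<in> dom_A"
    and "op_A (x + y) = op_A x + op_A y" and "op_A (c *\<^sub>C x) = c *\<^sub>C op_A x"
proof -
  obtain u v w u' v' w' where xy: "x = (u, v, w)" "y = (u', v', w')" by (metis prod.exhaust)
  note x = assms(1)[unfolded xy dom_A_iff] and y = assms(2)[unfolded xy dom_A_iff]
  note H = H2_space_H1[OF x[THEN conjunct1]] H2_space_H1[OF y[THEN conjunct1]]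
    H2_space_H1[OF x[THEN conjunct2, THEN conjunct2, THEN conjunct1]]
    H2_space_H1[OF y[THEN conjunct2, THEN conjunct2, THEN conjunct1]]
  have L: "L2_to_H1 (v + v') = L2_to_H1 v + L2_to_H1 v'" "L2_to_H1 (c *\<^sub>C v) = c *\<^sub>C L2_to_H1 v"
    using x y by (auto simp: plus_H1_def scaleC_H1_def L2_to_H1_inverse)
  note pvs = point_value_ops[where 'i=wave_ivl, unfolded wave_ends] point_value_ops[where 'i=heat_ivl, unfolded heat_ends]
    point_value_scaleC[where 'i=wave_ivl, unfolded wave_ends] point_value_scaleC[where 'i=heat_ivl, unfolded heat_ends]
  show "x + y \<in> dom_A" "c *\<^sub>C x \<in> dom_A"
    using x y H
    by (simp_all add: xy scaleC_prod_def dom_A_iff plus_H1.rep_eq scaleC_H1.rep_eq H2_space_add H2_space_scaleC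
      H1_space_closed(1) H1_space_scaleC wD_add wD_scaleC pvs)
  show "op_A (x + y) = op_A x + op_A y" "op_A (c *\<^sub>C x) = c *\<^sub>C op_A x"
    using H by (simp_all add: xy scaleC_prod_def op_A_def plus_H1.rep_eq scaleC_H1.rep_eq L wD_add wD_scaleC)
qed

lemma norm_H1_square: "(norm u)\<^sup>2 = (norm (H1_to_L2 u))\<^sup>2 + (norm (wD (H1_to_L2 u)))\<^sup>2"
  unfolding power2_norm_eq_inner by (simp add: inner_H1.rep_eq)

lemma norm_state_square: "(norm ((u, v, w) :: state))\<^sup>2 =
    (norm (H1_to_L2 u))\<^sup>2 + (norm (wD (H1_to_L2 u)))\<^sup>2 + (norm v)\<^sup>2 + (norm w)\<^sup>2"
  by (simp add: norm_prod_def norm_H1_square)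

lemma H1_to_L2_H1: "H1_to_L2 u \<in> H1_space"
  by (rule H1_to_L2)

lemma resolvent_lower_bound:
  assumes s: "1 \<le> \<bar>s\<bar>" and x: "x \<in> dom_A"
  shows "norm x \<le> 300 * sqrt \<bar>s\<bar> * norm ((\<i> * complex_of_real s) *\<^sub>C x - op_A x)"
proof -
  obtain u v w where uvw: "x = (u, v, w)" by (metis prod.exhaust)
  note x' = x[unfolded uvw dom_A_iff]
  obtain f g h where y: "(\<i> * complex_of_real s) *\<^sub>C x - op_A x = (f, g, h)" by (metis prod.exhaust)
  then have eqs: "(\<i> * complex_of_real s) *\<^sub>C H1_to_L2 u - v = H1_to_L2 f"
    "(\<i> * complex_of_real s) *\<^sub>C v - wD (wD (H1_to_L2 u)) = g" "(\<i> * complex_of_real s) *\<^sub>C w - wD (wD w) = h"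
    using x' by (auto simp: uvw op_A_def scaleC_prod_def scaleC_H1.rep_eq minus_H1.rep_eq L2_to_H1_inverse)
  have "(norm x)\<^sup>2 \<le> (300 * sqrt \<bar>s\<bar> * norm ((f, g, h) :: state))\<^sup>2"
    using a_priori_estimate[OF s _ _ _ _ eqs] x' H1_to_L2_H1[of f]
    unfolding power_mult_distrib norm_state_square uvw by simp
  then show ?thesis
    unfolding y by (rule power2_le_imp_le) simp
qed

text \<open>On the wave side the condition \<open>u'(-1) = 0\<close> leaves one free parameter \<open>u(-1)\<close>, on the heat side
\<open>w(1) = 0\<close> leaves the parameter \<open>w'(1)\<close>. The two coupling conditions at \<open>0\<close> are linear in these
parameters, and \<open>T\<close> is the linear part. A vector in its kernel gives a solution of
the homogeneous problem, which vanishes by \<open>a_priori_estimate\<close>. So \<open>T\<close> is injective and hence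
surjective.\<close>

lemma range_resolvent:
  assumes s: "1 \<le> \<bar>s\<bar>"
  shows "\<exists>x\<in>dom_A. (\<i> * complex_of_real s) *\<^sub>C x - op_A x = y"
proof -
  let ?c = "\<i> * complex_of_real s"
  obtain f g h where y: "y = (f, g, h)" by (metis prod.exhaust)
  have csq: "?c\<^sup>2 = ?c * ?c" "(csqrt ?c)\<^sup>2 = ?c" by (rule power2_eq_square, rule power2_csqrt)
  have ivl: "-1 \<in> {left_end TYPE(wave_ivl)..right_end TYPE(wave_ivl)}" "0 \<in> {left_end TYPE(wave_ivl)..right_end TYPE(wave_ivl)}"
    "1 \<in> {left_end TYPE(heat_ivl)..right_end TYPE(heat_ivl)}" "0 \<in> {left_end TYPE(heat_ivl)..right_end TYPE(heat_ivl)}"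
    by (simp_all add: wave_ends heat_ends)
  \<comment> \<open>Eliminating \<open>v\<close> turns the wave system into \<open>u'' = (is)\<^sup>2 u - (is f + g)\<close>.\<close>
  obtain up :: "wave_ivl L2" where up: "up \<in> H2_space" "wD (wD up) = ?c\<^sup>2 *\<^sub>C up + (- (?c *\<^sub>C H1_to_L2 f + g))"
    "point_value up (-1) = 0" "point_value (wD up) (-1) = 0"
    using second_order_ivp[OF ivl(1)] by blast
  obtain u1 :: "wave_ivl L2" where u1: "u1 \<in> H2_space" "wD (wD u1) = ?c\<^sup>2 *\<^sub>C u1 + 0"
    "point_value u1 (-1) = 1" "point_value (wD u1) (-1) = 0"
    using second_order_ivp[OF ivl(1)] by blast
  obtain wp :: "heat_ivl L2" where wp: "wp \<in> H2_space" "wD (wD wp) = (csqrt ?c)\<^sup>2 *\<^sub>C wp + (- h)"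
    "point_value wp 1 = 0" "point_value (wD wp) 1 = 0"
    using second_order_ivp[OF ivl(3)] by blast
  obtain w1 :: "heat_ivl L2" where w1: "w1 \<in> H2_space" "wD (wD w1) = (csqrt ?c)\<^sup>2 *\<^sub>C w1 + 0"
    "point_value w1 1 = 0" "point_value (wD w1) 1 = 1"
    using second_order_ivp[OF ivl(3)] by blast
  have H: "up \<in> H1_space" "wD up \<in> H1_space" "u1 \<in> H1_space" "wD u1 \<in> H1_space"
    "wp \<in> H1_space" "wD wp \<in> H1_space" "w1 \<in> H1_space" "wD w1 \<in> H1_space"
    using up(1) u1(1) wp(1) w1(1) H2_space_H1 by blast+
  note pvs = point_value_ops[where 'i=wave_ivl, unfolded wave_ends] point_value_ops[where 'i=heat_ivl, unfolded heat_ends]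
    point_value_scaleC[where 'i=wave_ivl, unfolded wave_ends] point_value_scaleC[where 'i=heat_ivl, unfolded heat_ends]
  define T where "T = (\<lambda>(a, b). (?c * (a * point_value u1 0) - b * point_value w1 0,
      a * point_value (wD u1) 0 - b * point_value (wD w1) 0))"
  have "linear T"
    by (rule linearI) (auto simp: T_def algebra_simps scaleR_conv_of_real split: prod.splits)
  moreover have "inj T"
  proof (subst linear_injective_0[OF \<open>linear T\<close>], intro allI impI)
    fix p assume "T p = 0"
    obtain a b where p: "p = (a, b)" by (metis prod.exhaust)
    have T0: "?c * (a * point_value u1 0) = b * point_value w1 0"
      "a * point_value (wD u1) 0 = b * point_value (wD w1) 0"
      using \<open>T p = 0\<close> by (simp_all add: T_def p zero_prod_def)
    define U where "U = a *\<^sub>C u1"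
    define W where "W = b *\<^sub>C w1"
    have UW: "U \<in> H2_space" "?c *\<^sub>C U \<in> H1_space" "W \<in> H2_space"
      unfolding U_def W_def by (intro H2_space_scaleC H1_space_scaleC u1 w1 H)+
    have "(norm U)\<^sup>2 + (norm (wD U))\<^sup>2 + (norm (?c *\<^sub>C U))\<^sup>2 + (norm W)\<^sup>2 \<le>
      300\<^sup>2 * \<bar>s\<bar> * ((norm (0 :: wave_ivl L2))\<^sup>2 + (norm (wD (0 :: wave_ivl L2)))\<^sup>2
        + (norm (0 :: wave_ivl L2))\<^sup>2 + (norm (0 :: heat_ivl L2))\<^sup>2)"
    proof (rule a_priori_estimate[OF s UW zero_in_H1_space])
      show "?c *\<^sub>C ?c *\<^sub>C U - wD (wD U) = 0" "?c *\<^sub>C W - wD (wD W) = 0"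
        using H u1(2) w1(2) csq
        by (simp_all add: U_def W_def wD_scaleC H1_space_scaleC scaleC_scaleC mult_ac)
      show "point_value (wD U) (-1) = 0" "point_value W 1 = 0" "point_value (?c *\<^sub>C U) 0 = point_value W 0"
        "point_value (wD U) 0 = point_value (wD W) 0"
        using H u1(4) w1(3) T0
        by (simp_all add: U_def W_def wD_scaleC pvs scaleC_scaleC mult.assoc)
    qed simp
    then have "(norm U)\<^sup>2 + (norm (wD U))\<^sup>2 + (norm (?c *\<^sub>C U))\<^sup>2 + (norm W)\<^sup>2 \<le> 0"
      by (simp add: wD_zero)
    then have "(norm U)\<^sup>2 = 0 \<and> (norm W)\<^sup>2 = 0"
      using zero_le_power2[of "norm U"] zero_le_power2[of "norm (wD U)"]
        zero_le_power2[of "norm (?c *\<^sub>C U)"] zero_le_power2[of "norm W"] by linarith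
    moreover have "u1 \<noteq> 0" "w1 \<noteq> 0"
    proof -
      have "point_value (0 :: wave_ivl L2) (-1) = 0" "point_value (0 :: heat_ivl L2) 1 = 0"
        unfolding zero_L2_abs by (rule point_value_abs, simp, rule ivl)+
      then show "u1 \<noteq> 0" "w1 \<noteq> 0" using u1(3) w1(4) by (auto simp: wD_zero)
    qed
    ultimately show "p = 0"
      by (auto simp: U_def W_def norm_scaleC p zero_prod_def)
  qed
  ultimately have "surj T" using eucl.linear_inj_imp_surj by blast
  then obtain p where "T p = (point_value (H1_to_L2 f) 0 + point_value wp 0 - ?c * point_value up 0,
      point_value (wD wp) 0 - point_value (wD up) 0)"
    by (metis surjD)
  then obtain a b where T: "T (a, b) = (point_value (H1_to_L2 f) 0 + point_value wp 0 - ?c * point_value up 0,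
      point_value (wD wp) 0 - point_value (wD up) 0)" by (metis prod.exhaust)
  define U where "U = up + a *\<^sub>C u1"
  define W where "W = wp + b *\<^sub>C w1"
  define V where "V = ?c *\<^sub>C U - H1_to_L2 f"
  have au: "a *\<^sub>C u1 \<in> H1_space" "a *\<^sub>C wD u1 \<in> H1_space" and bw: "b *\<^sub>C w1 \<in> H1_space" "b *\<^sub>C wD w1 \<in> H1_space"
    using H by (auto intro: H1_space_scaleC)
  have U2: "U \<in> H2_space" and W2: "W \<in> H2_space"
    unfolding U_def W_def using up(1) u1(1) wp(1) w1(1) by (auto intro!: H2_space_add H2_space_scaleC)
  have U1: "U \<in> H1_space" "wD U \<in> H1_space" using U2 H2_space_H1 by blast+
  have V1: "V \<in> H1_space" unfolding V_def using U1 H1_to_L2_H1 by (auto intro!: H1_space_closed(2) H1_space_scaleC)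
  have dU: "wD U = wD up + a *\<^sub>C wD u1" "wD W = wD wp + b *\<^sub>C wD w1"
    unfolding U_def W_def using H au bw by (simp_all add: wD_add wD_scaleC)
  have ddU: "wD (wD U) = ?c *\<^sub>C V - g"
    unfolding dU V_def U_def using H au up(2) u1(2)
    by (simp add: wD_add wD_scaleC scaleC_add_right scaleC_diff_right scaleC_scaleC power2_eq_square mult_ac)
  have ddW: "wD (wD W) = ?c *\<^sub>C W - h"
    unfolding dU W_def using H bw wp(2) w1(2)
    by (simp add: wD_add wD_scaleC scaleC_add_right scaleC_scaleC csq mult_ac)
  have LU: "H1_to_L2 (L2_to_H1 U) = U" "H1_to_L2 (L2_to_H1 V) = V"
    using U1 V1 by (simp_all add: L2_to_H1_inverse)
  have "(L2_to_H1 U, V, W) \<in> dom_A"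
  proof -
    have 1: "?c * (a * point_value u1 0) - b * point_value w1 0 =
        point_value (H1_to_L2 f) 0 + point_value wp 0 - ?c * point_value up 0"
      "a * point_value (wD u1) 0 - b * point_value (wD w1) 0 = point_value (wD wp) 0 - point_value (wD up) 0"
      using T by (simp_all add: T_def)
    have "point_value (wD U) (-1) = 0" "point_value W 1 = 0"
      unfolding dU W_def using H au bw up(4) u1(4) wp(3) w1(3) by (simp_all add: pvs)
    moreover have "point_value V 0 = ?c * (point_value up 0 + a * point_value u1 0) - point_value (H1_to_L2 f) 0"
      unfolding V_def using U1 H1_to_L2_H1[of f] H au
      by (simp add: pvs H1_space_scaleC) (simp add: U_def pvs H1_space_scaleC)
    moreover have "point_value W 0 = point_value wp 0 + b * point_value w1 0"
      unfolding W_def using H bw by (simp add: pvs)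
    moreover have "point_value (wD U) 0 = point_value (wD up) 0 + a * point_value (wD u1) 0"
      "point_value (wD W) 0 = point_value (wD wp) 0 + b * point_value (wD w1) 0"
      unfolding dU using H au bw by (simp_all add: pvs)
    ultimately show ?thesis
      unfolding dom_A_iff LU using U2 V1 W2 1 by (simp add: algebra_simps)
  qed
  moreover have "?c *\<^sub>C (L2_to_H1 U, V, W) - op_A (L2_to_H1 U, V, W) = y"
  proof -
    have "H1_to_L2 (?c *\<^sub>C L2_to_H1 U - L2_to_H1 V) = H1_to_L2 f"
      unfolding minus_H1.rep_eq scaleC_H1.rep_eq LU by (simp add: V_def)
    then show ?thesis
      by (simp add: y scaleC_prod_def op_A_def LU ddU ddW H1_to_L2_inject)
  qed
  ultimately show ?thesis by blast
qed

theorem theorem3p1: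
  shows "\<exists>C>0. \<exists>s0>0. \<forall>s::real. \<bar>s\<bar> \<ge> s0 \<longrightarrow>
    \<i> * complex_of_real s \<in> resolvent_set dom_A op_A \<and>
    onorm (resolvent dom_A op_A (\<i> * complex_of_real s)) \<le> C * \<bar>s\<bar> powr (1 / 2)"
proof -
  have "\<i> * complex_of_real s \<in> resolvent_set dom_A op_A \<and>
    onorm (resolvent dom_A op_A (\<i> * complex_of_real s)) \<le> 300 * \<bar>s\<bar> powr (1 / 2)"
    if s: "1 \<le> \<bar>s\<bar>" for s
    unfolding powr_half_sqrt[OF abs_ge_zero]
    by (intro conjI resolvent_set_and_norm[where M = "300 * sqrt \<bar>s\<bar>"] range_resolvent[OF s] resolvent_lower_bound[OF s])
      (auto intro: dom_A_add_scale)
  then have "\<exists>s0>0. \<forall>s::real. \<bar>s\<bar> \<ge> s0 \<longrightarrow>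
    \<i> * complex_of_real s \<in> resolvent_set dom_A op_A \<and>
    onorm (resolvent dom_A op_A (\<i> * complex_of_real s)) \<le> 300 * \<bar>s\<bar> powr (1 / 2)"
    by (intro exI[of _ 1]) simp
  then show ?thesis by (intro exI[of _ 300]) simp
qed

end
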